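(* Fix $t\in(0,1)$. For each $m\ge 1$ let $\boldsymbol{\zeta}_m=\boldsymbol{\mu}_m+\boldsymbol{\eta}_m+\mathbf{v}_m$, where $\boldsymbol{\mu}_m\in\mathbb{R}^m$ and $\boldsymbol{\eta}_m\sim\mathsf{N}_m(\mathbf{0},\boldsymbol{\Sigma}_{\boldsymbol{\eta}})$ and $\mathbf{v}_m\sim\mathsf{N}_m(\mathbf{0},\boldsymbol{\Sigma}_{\mathbf{v}})$ are independent. Let $\mathbf{R}_{\mathbf{v}}$ be the correlation matrix of $\mathbf{v}_m$, $\boldsymbol{\sigma}_{\mathbf{v},m}=(\sigma_{1,m},\ldots,\sigma_{m,m})$ the vector of standard deviations of the components of $\mathbf{v}_m$, and $$\sigma_0=\lim_{m\to\infty}\min\{\sigma_{i,m}:\sigma_{i,m}\ne 0,\ 1\le i\le m\}.$$ Assume $\sigma_0>0$ and $m^{-2}\|\mathbf{R}_{\mathbf{v}}\|_1=O(m^{-\delta})$ for some $\delta>0$. If for any natural numbers $m,m'$ such that $m\le m'$ and $m\to\infty$ $$\max\left\{\left\|\boldsymbol{\eta}_m-\boldsymbol{\eta}_{m'}^{(m)}\right\|_2,\ \left\|\boldsymbol{\mu}_m-\boldsymbol{\mu}_{m'}^{(m)}\right\|_2,\ \left\|\boldsymbol{\sigma}_{\mathbf{v},m}-\boldsymbol{\sigma}_{\mathbf{v},m'}^{(m)}\right\|_2\right\}\to 0\quad\text{a.s.},$$ then $$m^{-1}\left|R_m(t|\boldsymbol{\eta})-\mathbb{E}_{\mathbf{v}}[R_m(t|\boldsymbol{\eta})]\right|\to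 0\ \text{a.s.}\quad\text{and}\quad m^{-1}\left|V_m(t|\boldsymbol{\eta})-\mathbb{E}_{\mathbf{v}}[V_m(t|\boldsymbol{\eta})]\right|\to 0\ \text{a.s.}$$ If in addition $\liminf_{m\to\infty}\pi_{0,m}>0$, then $$m^{-1}\left|\mathrm{FDP}_m(t|\boldsymbol{\eta})-\mathbb{E}_{\mathbf{v}}[\mathrm{FDP}_m(t|\boldsymbol{\eta})]\right|\to 0\ \text{a.s.}$$
   Context: All random vectors live on one probability space $(\Omega,\mathcal{F},\mathbb{P})$. $\mathsf{N}_m(\mathbf{a},\mathbf{C})$ is the Normal distribution with mean $\mathbf{a}$ and (possibly singular) covariance matrix $\mathbf{C}$; $\Phi$ is the CDF of $\mathsf{N}_1(0,1)$. For a matrix $\mathbf{A}$, $\|\mathbf{A}\|_1=\sum_{i,j}|\mathbf{A}(i,j)|$; $\|\cdot\|_2$ is the Euclidean norm on vectors. For $\mathbf{a}=(a_1,\ldots,a_{m'})$ and $m\le m'$, $\mathbf{a}^{(m)}=(a_1,\ldots,a_m)$. The subscript $m$ is dropped when convenient: $\boldsymbol{\mu}=\boldsymbol{\mu}_m$, $\boldsymbol{\eta}=\boldsymbol{\eta}_m$, $\mathbf{v}=\mathbf{v}_m$, with components $\mu_i,\eta_i,v_i$ (which may depend on $m$). $\boldsymbol{\Sigma}=\boldsymbol{\Sigma}_{\boldsymbol{\eta}}+\boldsymbol{\Sigma}_{\mathbf{v}}=(\tilde\sigma_{ij})$ is the covariance matrix of $\boldsymbol{\zeta}_m$, and all variances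 $\tilde\sigma_{ii}$ are nonzero. Correlations involving a component $v_i$ of zero variance are taken to be $0$. The p-values for testing $\mu_i=0$ are either all one-sided, $p_i=1-\Phi(\tilde\sigma_{ii}^{-1/2}\zeta_i)$, or all two-sided, $p_i=2\Phi(-\tilde\sigma_{ii}^{-1/2}|\zeta_i|)$; the result is asserted for both types. $X_i=1_{\{p_i\le t\,|\,\boldsymbol{\eta}\}}$ is the indicator of $p_i\le t$ considered conditionally on $\boldsymbol{\eta}$, i.e. with $\zeta_i=\mu_i+\eta_i+v_i$, the value of $\boldsymbol{\eta}$ held fixed and the randomness coming from $\mathbf{v}$. $Q_{0,m}=\{1\le i\le m:\mu_i=0\}$, $\pi_{0,m}=|Q_{0,m}|/m$, $R_m(t|\boldsymbol{\eta})=\sum_{i=1}^m X_i$, $V_m(t|\boldsymbol{\eta})=\sum_{i\in Q_{0,m}}X_i$, $\mathrm{FDP}_m(t|\boldsymbol{\eta})=V_m(t|\boldsymbol{\eta})/(R_m(t|\boldsymbol{\eta})\vee 1)$. $\mathbb{E}_{\mathbf{v}}$ is expectation with respect to the distribution of $\mathbf{v}$. *)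

theory Defs
  imports "HOL-Probability.Probability"
begin

(* Vectors in R^m are functions on the index set {1..m}, since m varies inside the statement.
   A random vector takes values in the product space below, so it is extensional on {1..m};
   deterministic vectors and matrices are only ever read at indices in {1..m}. *)

abbreviation vec_space :: "nat \<Rightarrow> (nat \<Rightarrow> real) measure" where
  "vec_space m \<equiv> PiM {1..m} (\<lambda>_. borel)"

abbreviation law :: "'w measure \<Rightarrow> nat \<Rightarrow> ('w \<Rightarrow> nat \<Rightarrow> real) \<Rightarrow> (nat \<Rightarrow> real) measure" where
  "law M m X \<equiv> distr M (vec_space m) X"

(* X ~ N_m(a, C) with C possibly singular: X has the law of a + A Z, where A A^T = C and Z is
   a vector of k independent standard normal variables. *)
definition normal_vector ::
  "'w measure \<Rightarrow> nat \<Rightarrow> ('w \<Rightarrow> nat \<Rightarrow> real) \<Rightarrow> (nat \<Rightarrow> real) \<Rightarrow> (nat \<Rightarrow> nat \<Rightarrow> real) \<Rightarrow> bool"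
where
  "normal_vector M m X a C \<longleftrightarrow>
     X \<in> measurable M (vec_space m) \<and>
     (\<exists>(k::nat) (A :: nat \<Rightarrow> nat \<Rightarrow> real).
        (\<forall>i\<in>{1..m}. \<forall>j\<in>{1..m}. C i j = (\<Sum>l<k. A i l * A j l)) \<and>
        law M m X =
          law (PiM {..<k} (\<lambda>_. std_normal_distribution)) m
            (\<lambda>z. \<lambda>i\<in>{1..m}. a i + (\<Sum>l<k. A i l * z l)))"

definition std_dev :: "(nat \<Rightarrow> nat \<Rightarrow> real) \<Rightarrow> nat \<Rightarrow> real" where
  "std_dev C i = sqrt (C i i)"

(* As x / 0 = 0, correlations involving a component of zero variance are 0. *)
definition corr_matrix :: "(nat \<Rightarrow> nat \<Rightarrow> real) \<Rightarrow> nat \<Rightarrow> nat \<Rightarrow> real" where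
  "corr_matrix C i j = C i j / (std_dev C i * std_dev C j)"

definition mat_norm1 :: "nat \<Rightarrow> (nat \<Rightarrow> nat \<Rightarrow> real) \<Rightarrow> real" where
  "mat_norm1 m A = (\<Sum>i=1..m. \<Sum>j=1..m. \<bar>A i j\<bar>)"

definition vec_norm2 :: "nat \<Rightarrow> (nat \<Rightarrow> real) \<Rightarrow> real" where
  "vec_norm2 m x = L2_set x {1..m}"

(* The minimum of the nonzero standard deviations; it is infinity if there are none. *)
definition min_nonzero_sd :: "nat \<Rightarrow> (nat \<Rightarrow> nat \<Rightarrow> real) \<Rightarrow> ereal" where
  "min_nonzero_sd m C = (INF i\<in>{i\<in>{1..m}. std_dev C i \<noteq> 0}. ereal (std_dev C i))"

definition std_normal_cdf :: "real \<Rightarrow> real" ("\<Phi>") where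
  "\<Phi> x = cdf std_normal_distribution x"

(* p-values as functions of the standardised observation *)
definition one_sided_pvalue :: "real \<Rightarrow> real" where
  "one_sided_pvalue z = 1 - \<Phi> z"

definition two_sided_pvalue :: "real \<Rightarrow> real" where
  "two_sided_pvalue z = 2 * \<Phi> (- \<bar>z\<bar>)"

(* In the following p is the p-value function, s the vector of variances of the observations,
   and h and v are the realised values of eta and v. Conditioning on eta means that h is held
   fixed while v is integrated over. *)

definition reject_ind ::
  "(real \<Rightarrow> real) \<Rightarrow> real \<Rightarrow> (nat \<Rightarrow> real) \<Rightarrow> (nat \<Rightarrow> real) \<Rightarrow> (nat \<Rightarrow> real) \<Rightarrow> (nat \<Rightarrow> real) \<Rightarrow> nat \<Rightarrow> real"
where
  "reject_ind p t \<mu> s h v i = (if p ((\<mu> i + h i + v i) / sqrt (s i)) \<le> t then 1 else 0)"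

definition true_nulls :: "nat \<Rightarrow> (nat \<Rightarrow> real) \<Rightarrow> nat set" where
  "true_nulls m \<mu> = {i\<in>{1..m}. \<mu> i = 0}"

definition null_proportion :: "nat \<Rightarrow> (nat \<Rightarrow> real) \<Rightarrow> real" where
  "null_proportion m \<mu> = real (card (true_nulls m \<mu>)) / real m"

definition num_rejections ::
  "(real \<Rightarrow> real) \<Rightarrow> real \<Rightarrow> nat \<Rightarrow> (nat \<Rightarrow> real) \<Rightarrow> (nat \<Rightarrow> real) \<Rightarrow> (nat \<Rightarrow> real) \<Rightarrow> (nat \<Rightarrow> real) \<Rightarrow> real"
where
  "num_rejections p t m \<mu> s h v = (\<Sum>i=1..m. reject_ind p t \<mu> s h v i)"

definition num_false_rejections ::
  "(real \<Rightarrow> real) \<Rightarrow> real \<Rightarrow> nat \<Rightarrow> (nat \<Rightarrow> real) \<Rightarrow> (nat \<Rightarrow> real) \<Rightarrow> (nat \<Rightarrow> real) \<Rightarrow> (nat \<Rightarrow> real) \<Rightarrow> real"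
where
  "num_false_rejections p t m \<mu> s h v = (\<Sum>i\<in>true_nulls m \<mu>. reject_ind p t \<mu> s h v i)"

definition false_discovery_prop ::
  "(real \<Rightarrow> real) \<Rightarrow> real \<Rightarrow> nat \<Rightarrow> (nat \<Rightarrow> real) \<Rightarrow> (nat \<Rightarrow> real) \<Rightarrow> (nat \<Rightarrow> real) \<Rightarrow> (nat \<Rightarrow> real) \<Rightarrow> real"
where
  "false_discovery_prop p t m \<mu> s h v =
     num_false_rejections p t m \<mu> s h v / max (num_rejections p t m \<mu> s h v) 1"

end

theory Submission
  imports Defs "HOL-Real_Asymp.Real_Asymp"
begin

text \<open>
  For fixed \<open>\<eta>\<close> the rejection indicators are functions of the standardised components of \<open>v\<close>, which
  are linear forms in a standard Gaussian vector \<open>Z\<close>. Each indicator is squeezed between two \<open>C\<^sup>1\<close>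
  functions with derivative at most \<open>4/\<epsilon>\<close> whose means differ by at most \<open>2\<epsilon>\<close>. The normalised sum
  \<open>F\<close> of such functions has squared gradient \<open>\<le> (4/\<epsilon>)\<^sup>2 m\<^sup>-\<^sup>2 \<parallel>R\<^sub>v\<parallel>\<^sub>1 = O(m\<^sup>-\<^sup>\<delta>)\<close>, so Gaussian
  concentration bounds the probability of an \<open>\<epsilon>\<close>-deviation by \<open>2 exp (- c m\<^sup>\<delta>)\<close>. This bound is summable
  for every \<open>\<delta> > 0\<close>, and Fubini and Borel--Cantelli conclude. The false discovery proportion lies
  in \<open>[0, 1]\<close>, so its statement is immediate.
\<close>

section \<open>Rotation invariance of the standard Gaussian measure\<close>

text \<open>Two obstacles shape the argument. A second-moment bound would give deviation
  probabilities of order \<open>m powr (- \<delta>)\<close>, which are not summable for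
  \<open>\<delta> \<le> 1\<close>; hence the exponential inequality. That inequality needs a
  Lipschitz function, and an indicator is none; hence the smoothing. The smoothing takes place in
  the standardised component of \<open>v\<close>, with offset and scale absorbed into the threshold
  set. So the derivative bound depends neither on \<open>\<mu>\<close> and \<open>\<eta>\<close> nor
  on the variances, the error is controlled by the density of a single standard normal variable, and
  a component of zero variance yields a constant, which needs no smoothing. If the standardised
  components are the scalar products of \<open>Z\<close> with row vectors, the squared gradient of
  \<open>F\<close> is a quadratic form in the derivatives whose matrix consists of the scalar
  products of the rows. These are the correlations, and this is how \<open>mat_norm1\<close> enters.
  The resulting bound is the same for every value of \<open>\<eta>\<close>, so it survives
  integration over \<open>\<eta>\<close>.\<close>

text \<open>The rotation is split into two affine substitutions on the line,
  \<open>u = c * x + s * y\<close> at fixed \<open>y\<close> and then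
  \<open>w = (y - s * u) / c\<close> at fixed \<open>u\<close>, with Tonelli in between. Both
  produce the factor \<open>\<bar>c\<bar>\<close>, which cancels; the quarter turn
  \<open>c = 0\<close> is excluded.\<close>

lemma nn_integral_lborel_rotation:
  fixes f :: "real \<times> real \<Rightarrow> ennreal" and c s :: real
  assumes f [measurable]: "f \<in> borel_measurable borel" and cs: "c\<^sup>2 + s\<^sup>2 = 1" and c: "c \<noteq> 0"
  shows "(\<integral>\<^sup>+x. \<integral>\<^sup>+y. f (c * x + s * y, - s * x + c * y) \<partial>lborel \<partial>lborel) =
    (\<integral>\<^sup>+x. \<integral>\<^sup>+y. f (x, y) \<partial>lborel \<partial>lborel)"
proof -
  have [measurable]: "f \<in> borel_measurable (borel \<Otimes>\<^sub>M borel)"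
    using f by (simp only: borel_prod)
  have [simp]: "c * c + s * s = 1"
    using cs by (simp add: power2_eq_square)
  have 1: "(\<integral>\<^sup>+u. f (u, (y - s * u) / c) \<partial>lborel) =
      \<bar>c\<bar> * (\<integral>\<^sup>+x. f (c * x + s * y, - s * x + c * y) \<partial>lborel)" for y
  proof -
    have "(y - s * (s * y + c * x)) / c = - s * x + c * y" for x
    proof -
      have "y - s * (s * y + c * x) = (c * c + s * s) * y - s * (s * y + c * x)"
        by simp
      also have "\<dots> = c * (- s * x + c * y)"
        by algebra
      finally show ?thesis
        using c by simp
    qed
    then show ?thesis
      by (subst nn_integral_real_affine[OF _ c, where t = "s * y"]) (auto simp: add.commute)
  qed
  have "\<bar>c\<bar> * (\<integral>\<^sup>+x. \<integral>\<^sup>+y. f (c * x + s * y, - s * x + c * y) \<partial>lborel \<partial>lborel) =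
      \<bar>c\<bar> * (\<integral>\<^sup>+y. \<integral>\<^sup>+x. f (c * x + s * y, - s * x + c * y) \<partial>lborel \<partial>lborel)"
    by (subst lborel_pair.Fubini') auto
  also have "\<dots> = (\<integral>\<^sup>+y. \<integral>\<^sup>+u. f (u, (y - s * u) / c) \<partial>lborel \<partial>lborel)"
    unfolding 1 by (rule nn_integral_cmult[symmetric]) simp
  also have "\<dots> = (\<integral>\<^sup>+u. \<integral>\<^sup>+y. f (u, (y - s * u) / c) \<partial>lborel \<partial>lborel)"
    by (subst lborel_pair.Fubini') auto
  also have "\<dots> = (\<integral>\<^sup>+u. \<bar>c\<bar> * (\<integral>\<^sup>+w. f (u, w) \<partial>lborel) \<partial>lborel)"
  proof (rule nn_integral_cong)
    fix u
    show "(\<integral>\<^sup>+y. f (u, (y - s * u) / c) \<partial>lborel) = \<bar>c\<bar> * (\<integral>\<^sup>+w. f (u, w) \<partial>lborel)"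
      using c by (subst nn_integral_real_affine[OF _ c, where t = "s * u"]) auto
  qed
  also have "\<dots> = \<bar>c\<bar> * (\<integral>\<^sup>+u. \<integral>\<^sup>+w. f (u, w) \<partial>lborel \<partial>lborel)"
    by (rule nn_integral_cmult) simp
  finally show ?thesis
    using c by (simp add: ennreal_mult_cancel_left)
qed

lemma measurable_std_normal [simp]:
  "measurable std_normal_distribution N = measurable borel N"
  by (rule measurable_cong_sets) simp_all

text \<open>The product density depends on \<open>x\<^sup>2 + y\<^sup>2\<close> only, which a
  rotation preserves, so the invariance of Lebesgue measure carries over.\<close>

lemma std_normal_pair_rotation:
  fixes c s :: real
  assumes cs: "c\<^sup>2 + s\<^sup>2 = 1" and c: "c \<noteq> 0"
  defines "T \<equiv> \<lambda>(x, y). (c * x + s * y, - s * x + c * y)"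
  shows "distr (std_normal_distribution \<Otimes>\<^sub>M std_normal_distribution)
      (std_normal_distribution \<Otimes>\<^sub>M std_normal_distribution) T =
    std_normal_distribution \<Otimes>\<^sub>M std_normal_distribution"
    (is "distr ?NN _ _ = _")
proof (rule measure_eqI)
  have [measurable_cong]: "sets ?NN = sets (borel \<Otimes>\<^sub>M borel)"
    by (intro sets_pair_measure_cong) simp_all
  have T[measurable]: "T \<in> measurable ?NN ?NN"
    unfolding T_def by measurable
  show "sets (distr ?NN ?NN T) = sets ?NN"
    by simp
  let ?\<phi> = std_normal_density
  have N: "(\<integral>\<^sup>+z. g z \<partial>?NN) = (\<integral>\<^sup>+x. \<integral>\<^sup>+y. (ennreal (?\<phi> x) * ennreal (?\<phi> y)) * g (x, y) \<partial>lborel \<partial>lborel)"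
    if g [measurable]: "g \<in> borel_measurable (borel \<Otimes>\<^sub>M borel)" for g
  proof -
    have "(\<integral>\<^sup>+z. g z \<partial>?NN) = (\<integral>\<^sup>+x. \<integral>\<^sup>+y. g (x, y) \<partial>std_normal_distribution \<partial>std_normal_distribution)"
      by (rule sigma_finite_measure.nn_integral_fst[symmetric])
        (auto intro!: prob_space_imp_sigma_finite prob_space_normal_density)
    also have "\<dots> = (\<integral>\<^sup>+x. \<integral>\<^sup>+y. (ennreal (?\<phi> x) * ennreal (?\<phi> y)) * g (x, y) \<partial>lborel \<partial>lborel)"
      by (simp add: nn_integral_density nn_integral_cmult mult.assoc)
    finally show ?thesis .
  qed
  fix A assume "A \<in> sets (distr ?NN ?NN T)"
  then have A: "A \<in> sets ?NN" by simp
  then have A' [measurable]: "A \<in> sets (borel \<Otimes>\<^sub>M borel)"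
    by simp
  have \<phi>: "?\<phi> x * ?\<phi> y = ?\<phi> (c * x + s * y) * ?\<phi> (- s * x + c * y)" for x y
  proof -
    have "(c * x + s * y)\<^sup>2 + (- s * x + c * y)\<^sup>2 = (c\<^sup>2 + s\<^sup>2) * (x\<^sup>2 + y\<^sup>2)"
      by algebra
    then have "- (x\<^sup>2) / 2 + - (y\<^sup>2) / 2 = - ((c * x + s * y)\<^sup>2) / 2 + - ((- s * x + c * y)\<^sup>2) / 2"
      by (simp add: cs)
    then have "exp (- (x\<^sup>2) / 2) * exp (- (y\<^sup>2) / 2) =
        exp (- ((c * x + s * y)\<^sup>2) / 2) * exp (- ((- s * x + c * y)\<^sup>2) / 2)"
      by (simp only: exp_add[symmetric])
    then show ?thesis
      by (simp add: std_normal_density_def)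
  qed
  define G where "G z = (ennreal (?\<phi> (fst z)) * ennreal (?\<phi> (snd z))) * indicator A z" for z
  have "emeasure (distr ?NN ?NN T) A = (\<integral>\<^sup>+z. indicator A (T z) \<partial>?NN)"
    using A nn_integral_distr[OF T, of "indicator A"] by simp
  also have "\<dots> = (\<integral>\<^sup>+x. \<integral>\<^sup>+y. (ennreal (?\<phi> x) * ennreal (?\<phi> y)) * indicator A (T (x, y)) \<partial>lborel \<partial>lborel)"
    by (rule N) (simp add: T_def split_beta)
  also have "\<dots> = (\<integral>\<^sup>+x. \<integral>\<^sup>+y. G (c * x + s * y, - s * x + c * y) \<partial>lborel \<partial>lborel)"
  proof (intro nn_integral_cong)
    fix x y
    show "(ennreal (?\<phi> x) * ennreal (?\<phi> y)) * indicator A (T (x, y)) = G (c * x + s * y, - s * x + c * y)"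
      unfolding G_def T_def prod.case fst_conv snd_conv
        ennreal_mult[OF normal_density_nonneg normal_density_nonneg, symmetric] \<phi>[of x y] ..
  qed
  also have "\<dots> = (\<integral>\<^sup>+x. \<integral>\<^sup>+y. G (x, y) \<partial>lborel \<partial>lborel)"
    by (rule nn_integral_lborel_rotation[OF _ cs c]) (simp add: G_def borel_prod[symmetric])
  also have "\<dots> = (\<integral>\<^sup>+x. \<integral>\<^sup>+y. (ennreal (?\<phi> x) * ennreal (?\<phi> y)) * indicator A (x, y) \<partial>lborel \<partial>lborel)"
    by (simp add: G_def)
  also have "\<dots> = (\<integral>\<^sup>+z. indicator A z \<partial>?NN)"
    by (rule N[symmetric]) simp
  also have "\<dots> = emeasure ?NN A"
    using A by simp
  finally show "emeasure (distr ?NN ?NN T) A = emeasure ?NN A" .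
qed

text \<open>Two independent vectors become one vector of independent pairs, so that a map of the
  plane can act in each coordinate. Boxes determine the product measure, and the section of a box of
  pairs is again a box, whose measure factorises.\<close>

lemma distr_PiM_pair:
  fixes N :: "'i \<Rightarrow> 'a measure" and K :: "'i \<Rightarrow> 'b measure"
  assumes I: "finite I"
    and N: "\<And>i. prob_space (N i)" and K: "\<And>i. prob_space (K i)"
  shows "distr (PiM I N \<Otimes>\<^sub>M PiM I K) (PiM I (\<lambda>i. N i \<Otimes>\<^sub>M K i)) (\<lambda>(x, y). \<lambda>i\<in>I. (x i, y i)) =
    PiM I (\<lambda>i. N i \<Otimes>\<^sub>M K i)"
    (is "distr ?P ?Q ?Z = _")
proof -
  interpret N: product_prob_space N I by (simp add: product_prob_spaceI N)
  interpret K: product_prob_space K I by (simp add: product_prob_spaceI K)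
  have "prob_space (N i \<Otimes>\<^sub>M K i)" for i
    using N K by (simp add: prob_space_pair)
  then interpret NK: product_prob_space "\<lambda>i. N i \<Otimes>\<^sub>M K i" I by (simp add: product_prob_spaceI)
  show ?thesis
  proof (rule NK.PiM_eqI[OF I])
    have Z [measurable]: "?Z \<in> measurable ?P ?Q"
      unfolding split_beta' by measurable
    show "sets (distr ?P ?Q ?Z) = sets ?Q" by simp
    fix A assume A [measurable]: "\<And>i. i \<in> I \<Longrightarrow> A i \<in> sets (N i \<Otimes>\<^sub>M K i)"
    have PA: "Pi\<^sub>E I A \<in> sets ?Q"
      using I by (rule sets_PiM_I_finite) (rule A)
    have "emeasure (distr ?P ?Q ?Z) (Pi\<^sub>E I A) = emeasure ?P (?Z -` Pi\<^sub>E I A \<inter> space ?P)"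
      using Z PA by (rule emeasure_distr)
    also have "\<dots> = (\<integral>\<^sup>+x. emeasure (PiM I K) (Pair x -` (?Z -` Pi\<^sub>E I A \<inter> space ?P)) \<partial>PiM I N)"
      by (rule sigma_finite_measure.emeasure_pair_measure_alt)
        (rule prob_space_imp_sigma_finite[OF prob_space_PiM[OF K]], rule measurable_sets[OF Z PA])
    also have "\<dots> = (\<integral>\<^sup>+x. (\<Prod>i\<in>I. emeasure (K i) (Pair (x i) -` A i)) \<partial>PiM I N)"
    proof (rule nn_integral_cong)
      fix x assume x: "x \<in> space (PiM I N)"
      have sub: "Pair (x i) -` A i \<subseteq> space (K i)" if "i \<in> I" for i
        using sets.sets_into_space[OF A[OF that]] by (auto simp: space_pair_measure)
      have "Pair x -` (?Z -` Pi\<^sub>E I A \<inter> space ?P) = Pi\<^sub>E I (\<lambda>i. Pair (x i) -` A i)"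
      proof (intro set_eqI iffI)
        fix y assume "y \<in> Pair x -` (?Z -` Pi\<^sub>E I A \<inter> space ?P)"
        then have "y \<in> space (PiM I K)" and *: "(\<lambda>i\<in>I. (x i, y i)) \<in> Pi\<^sub>E I A"
          using x by (simp_all add: space_pair_measure)
        moreover have "(x i, y i) \<in> A i" if "i \<in> I" for i
          using PiE_mem[OF * that] that by simp
        ultimately show "y \<in> Pi\<^sub>E I (\<lambda>i. Pair (x i) -` A i)"
          by (auto simp: space_PiM PiE_iff)
      next
        fix y assume y: "y \<in> Pi\<^sub>E I (\<lambda>i. Pair (x i) -` A i)"
        then have "y \<in> space (PiM I K)"
          using sub unfolding space_PiM PiE_iff by blast
        moreover have "(\<lambda>i\<in>I. (x i, y i)) \<in> Pi\<^sub>E I A"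
          using y by (auto simp: PiE_iff)
        ultimately show "y \<in> Pair x -` (?Z -` Pi\<^sub>E I A \<inter> space ?P)"
          using x by (simp add: space_pair_measure)
      qed
      also have "emeasure (PiM I K) \<dots> = (\<Prod>i\<in>I. emeasure (K i) (Pair (x i) -` A i))"
        by (rule K.emeasure_PiM[OF I]) (rule sets_Pair1[OF A])
      finally show "emeasure (PiM I K) (Pair x -` (?Z -` Pi\<^sub>E I A \<inter> space ?P)) = \<dots>" .
    qed
    also have "\<dots> = (\<Prod>i\<in>I. \<integral>\<^sup>+a. emeasure (K i) (Pair a -` A i) \<partial>N i)"
      by (rule N.product_nn_integral_prod[OF I])
        (rule sigma_finite_measure.measurable_emeasure_Pair[OF prob_space_imp_sigma_finite[OF K] A])
    also have "\<dots> = (\<Prod>i\<in>I. emeasure (N i \<Otimes>\<^sub>M K i) (A i))"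
      by (rule prod.cong[OF refl])
        (rule sigma_finite_measure.emeasure_pair_measure_alt[OF prob_space_imp_sigma_finite[OF K] A, symmetric])
    finally show "emeasure (distr ?P ?Q ?Z) (Pi\<^sub>E I A) = (\<Prod>i\<in>I. emeasure (N i \<Otimes>\<^sub>M K i) (A i))" .
  qed
qed

lemma prob_space_std_normal: "prob_space std_normal_distribution"
  by (rule prob_space_normal_density) simp

text \<open>The rotation acts on each pair of coordinates separately: zip with \<open>Z\<close>,
  rotate coordinatewise, unzip with \<open>U\<close>.\<close>

lemma nn_integral_PiM_std_normal_rotation:
  fixes f :: "('i \<Rightarrow> real) \<times> ('i \<Rightarrow> real) \<Rightarrow> ennreal" and c s :: real
  assumes I: "finite I" and cs: "c\<^sup>2 + s\<^sup>2 = 1" and c: "c \<noteq> 0"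
  defines "P \<equiv> PiM I (\<lambda>_. std_normal_distribution)"
  assumes f [measurable]: "f \<in> borel_measurable (P \<Otimes>\<^sub>M P)"
  shows "(\<integral>\<^sup>+z. f (\<lambda>i\<in>I. c * fst z i + s * snd z i, \<lambda>i\<in>I. - s * fst z i + c * snd z i) \<partial>(P \<Otimes>\<^sub>M P)) =
    (\<integral>\<^sup>+z. f z \<partial>(P \<Otimes>\<^sub>M P))"
proof -
  let ?NN = "std_normal_distribution \<Otimes>\<^sub>M std_normal_distribution"
  define Q where "Q = PiM I (\<lambda>_. ?NN)"
  define Z :: "('i \<Rightarrow> real) \<times> ('i \<Rightarrow> real) \<Rightarrow> 'i \<Rightarrow> real \<times> real"
    where "Z = (\<lambda>(x, y). \<lambda>i\<in>I. (x i, y i))"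
  define U :: "('i \<Rightarrow> real \<times> real) \<Rightarrow> ('i \<Rightarrow> real) \<times> ('i \<Rightarrow> real)"
    where "U w = (\<lambda>i\<in>I. fst (w i), \<lambda>i\<in>I. snd (w i))" for w
  define T :: "real \<times> real \<Rightarrow> real \<times> real" where "T = (\<lambda>(x, y). (c * x + s * y, - s * x + c * y))"
  have P [measurable_cong]: "sets P = sets (PiM I (\<lambda>_. borel))"
    unfolding P_def by (intro sets_PiM_cong) simp_all
  have Q [measurable_cong]: "sets Q = sets (PiM I (\<lambda>_. borel \<Otimes>\<^sub>M borel))"
    unfolding Q_def by (intro sets_PiM_cong sets_pair_measure_cong) simp_all
  have NN [measurable_cong]: "sets ?NN = sets (borel \<Otimes>\<^sub>M borel)"
    by (intro sets_pair_measure_cong) simp_all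
  have NNp: "prob_space ?NN"
    by (intro prob_space_pair prob_space_std_normal)
  have Zm [measurable]: "Z \<in> measurable (P \<Otimes>\<^sub>M P) Q"
    unfolding Z_def split_beta' by measurable
  have Um [measurable]: "U \<in> measurable Q (P \<Otimes>\<^sub>M P)"
    unfolding U_def by measurable
  have Tm [measurable]: "T \<in> measurable (borel \<Otimes>\<^sub>M borel) (borel \<Otimes>\<^sub>M borel)"
    unfolding T_def by measurable
  then have Tm': "T \<in> measurable ?NN ?NN"
    by (subst measurable_cong_sets[OF NN NN])
  have Cm [measurable]: "compose I T \<in> measurable Q Q"
    unfolding compose_def by measurable
  have Z: "distr (P \<Otimes>\<^sub>M P) Q Z = Q"
    unfolding P_def Q_def Z_def by (rule distr_PiM_pair[OF I prob_space_std_normal prob_space_std_normal])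
  have C: "distr Q Q (compose I T) = Q"
  proof -
    have "distr Q Q (compose I T) = PiM I (\<lambda>_. distr ?NN ?NN T)"
      unfolding Q_def by (rule distr_PiM_finite_prob_space'[OF I NNp NNp Tm'])
    also have "distr ?NN ?NN T = ?NN"
      unfolding T_def using cs c by (rule std_normal_pair_rotation)
    finally show ?thesis unfolding Q_def .
  qed
  have fU: "(\<lambda>w. f (U w)) \<in> borel_measurable Q"
    by measurable
  have "(\<integral>\<^sup>+z. f (\<lambda>i\<in>I. c * fst z i + s * snd z i, \<lambda>i\<in>I. - s * fst z i + c * snd z i) \<partial>(P \<Otimes>\<^sub>M P)) =
      (\<integral>\<^sup>+z. f (U (compose I T (Z z))) \<partial>(P \<Otimes>\<^sub>M P))"
    by (intro nn_integral_cong arg_cong[where f = f])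
      (auto simp: U_def T_def Z_def compose_def split_beta' cong: restrict_cong)
  also have "\<dots> = (\<integral>\<^sup>+w. f (U (compose I T w)) \<partial>Q)"
    using nn_integral_distr[OF Zm, of "\<lambda>w. f (U (compose I T w))"] unfolding Z by simp
  also have "\<dots> = (\<integral>\<^sup>+w. f (U w) \<partial>Q)"
    using nn_integral_distr[OF Cm, of "\<lambda>w. f (U w)"] unfolding C by simp
  also have "\<dots> = (\<integral>\<^sup>+z. f (U (Z z)) \<partial>(P \<Otimes>\<^sub>M P))"
    using nn_integral_distr[OF Zm, of "\<lambda>w. f (U w)"] unfolding Z by simp
  also have "\<dots> = (\<integral>\<^sup>+z. f z \<partial>(P \<Otimes>\<^sub>M P))"
  proof (intro nn_integral_cong arg_cong[where f = f])
    fix z assume "z \<in> space (P \<Otimes>\<^sub>M P)"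
    \<comment> \<open>\<open>U\<close> undoes \<open>Z\<close> only on extensional functions, as
      both restrict to \<open>I\<close>.\<close>
    then have "fst z \<in> extensional I" "snd z \<in> extensional I"
      by (auto simp: space_pair_measure P_def space_PiM PiE_def)
    then show "U (Z z) = z"
      by (cases z) (auto simp: U_def Z_def extensional_def restrict_def fun_eq_iff)
  qed
  finally show ?thesis .
qed

section \<open>Exponential moments and Jensen's inequality\<close>

text \<open>Completing the square: \<open>exp (c * x)\<close> times the standard density is
  \<open>exp (c\<^sup>2 / 2)\<close> times the normal density with mean \<open>c\<close>.\<close>

lemma nn_integral_std_normal_exp:
  "(\<integral>\<^sup>+x. ennreal (exp (c * x)) \<partial>std_normal_distribution) = ennreal (exp (c\<^sup>2 / 2))"
proof -
  have "(\<integral>\<^sup>+x. ennreal (exp (c * x)) \<partial>std_normal_distribution) =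
      (\<integral>\<^sup>+x. ennreal (exp (c\<^sup>2 / 2)) * ennreal (normal_density c 1 x) \<partial>lborel)"
  proof (subst nn_integral_density; (intro nn_integral_cong)?)
    fix x :: real
    have "exp (- (x\<^sup>2) / 2) * exp (c * x) = exp (c\<^sup>2 / 2) * exp (- ((x - c)\<^sup>2) / 2)"
      unfolding exp_add[symmetric] by (simp add: power2_eq_square field_simps)
    then show "ennreal (std_normal_density x) * ennreal (exp (c * x)) =
        ennreal (exp (c\<^sup>2 / 2)) * ennreal (normal_density c 1 x)"
      by (simp add: ennreal_mult[symmetric] normal_density_nonneg)
        (simp add: normal_density_def)
  qed auto
  also have "\<dots> = ennreal (exp (c\<^sup>2 / 2)) * (\<integral>\<^sup>+x. ennreal (normal_density c 1 x) \<partial>lborel)"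
    by (rule nn_integral_cmult) simp
  also have "(\<integral>\<^sup>+x. ennreal (normal_density c 1 x) \<partial>lborel) = 1"
    using prob_space.emeasure_space_1[OF prob_space_normal_density[of 1 c]]
    by (simp add: emeasure_density)
  finally show ?thesis by simp
qed

lemma nn_integral_PiM_std_normal_exp:
  assumes I: "finite I"
  shows "(\<integral>\<^sup>+y. ennreal (exp (\<Sum>i\<in>I. c i * y i)) \<partial>PiM I (\<lambda>_. std_normal_distribution)) =
    ennreal (exp ((\<Sum>i\<in>I. (c i)\<^sup>2) / 2))"
proof -
  interpret product_prob_space "\<lambda>_. std_normal_distribution" I
    by (rule product_prob_spaceI) (rule prob_space_std_normal)
  have "(\<integral>\<^sup>+y. ennreal (exp (\<Sum>i\<in>I. c i * y i)) \<partial>PiM I (\<lambda>_. std_normal_distribution)) =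
      (\<integral>\<^sup>+y. (\<Prod>i\<in>I. ennreal (exp (c i * y i))) \<partial>PiM I (\<lambda>_. std_normal_distribution))"
    by (simp add: exp_sum[OF I] prod_ennreal)
  also have "\<dots> = (\<Prod>i\<in>I. \<integral>\<^sup>+x. ennreal (exp (c i * x)) \<partial>std_normal_distribution)"
    by (rule product_nn_integral_prod[OF I]) simp
  also have "\<dots> = ennreal (exp ((\<Sum>i\<in>I. (c i)\<^sup>2) / 2))"
    by (simp add: nn_integral_std_normal_exp prod_ennreal exp_sum[OF I, symmetric] sum_divide_distrib)
  finally show ?thesis .
qed

text \<open>Jensen's inequality for the uniform distribution on \<open>{0..1}\<close>. The tangent
  to the exponential at the mean \<open>b\<close> lies below it and integrates to exactly
  \<open>exp b\<close>.\<close>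

lemma exp_integral_le_nn_integral:
  fixes a :: "real \<Rightarrow> real"
  assumes a: "continuous_on {0..1} a" and b: "(a has_integral b) {0..1}"
  shows "ennreal (exp b) \<le> (\<integral>\<^sup>+u. indicator {0..1} u * ennreal (exp (a u)) \<partial>lborel)"
proof -
  obtain e where e: "((\<lambda>u. exp (a u)) has_integral e) {0..1}"
    using integrable_continuous_interval[OF continuous_on_exp[OF a]] by (auto simp: integrable_on_def)
  have "((\<lambda>u. exp b * ((1 - b) + a u)) has_integral exp b * ((1 - b) * (1 - 0) + b)) {0..1}"
    using has_integral_const_real[of "1 - b" 0 1] b
    by (intro has_integral_mult_right has_integral_add) (auto simp: mult.commute)
  then have "exp b * ((1 - b) * (1 - 0) + b) \<le> e"
  proof (rule has_integral_le[OF _ e])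
    fix u
    have "exp b * ((1 - b) + a u) \<le> exp b * exp (a u - b)"
      using exp_ge_add_one_self[of "a u - b"] by (intro mult_left_mono) (simp_all add: algebra_simps)
    then show "exp b * ((1 - b) + a u) \<le> exp (a u)"
      by (simp add: exp_add[symmetric])
  qed
  then have "ennreal (exp b) \<le> ennreal e"
    by (simp add: ennreal_leI)
  also have "ennreal e = (\<integral>\<^sup>+u. ennreal (indicator {0..1} u * exp (a u)) \<partial>lborel)"
    by (rule nn_integral_has_integral_lebesgue[symmetric, OF _ e]) simp
  also have "\<dots> = (\<integral>\<^sup>+u. indicator {0..1} u * ennreal (exp (a u)) \<partial>lborel)"
    by (intro nn_integral_cong) (auto split: split_indicator)
  finally show ?thesis .
qed

section \<open>Gaussian concentration\<close>

text \<open>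
  The argument of Maurey and Pisier: \<open>F y - F x\<close> is the integral of the derivative of \<open>F\<close> along the
  circular path \<open>x cos \<theta> + y sin \<theta>\<close>. By rotation invariance the point on the path and its velocity
  are again independent standard normal vectors, for every \<open>\<theta>\<close>.
\<close>

lemma nn_integral_exp_diff_le:
  fixes B :: "'j \<Rightarrow> 'i \<Rightarrow> real" and g g' :: "'j \<Rightarrow> real \<Rightarrow> real" and L :: real
  assumes I: "finite I" and J: "finite J"
    and g: "\<And>j x. j \<in> J \<Longrightarrow> (g j has_real_derivative g' j x) (at x)"
    and g'_cont: "\<And>j. j \<in> J \<Longrightarrow> continuous_on UNIV (g' j)"
    and g'_bound: "\<And>j x. j \<in> J \<Longrightarrow> \<bar>g' j x\<bar> \<le> L"
  defines "P \<equiv> PiM I (\<lambda>_. std_normal_distribution)"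
    and "F \<equiv> \<lambda>z. \<Sum>j\<in>J. g j (\<Sum>i\<in>I. B j i * z i)"
  shows "(\<integral>\<^sup>+z. ennreal (exp (F (snd z) - F (fst z))) \<partial>(P \<Otimes>\<^sub>M P)) \<le>
    ennreal (exp (pi\<^sup>2 / 8 * (L\<^sup>2 * (\<Sum>j\<in>J. \<Sum>k\<in>J. \<bar>\<Sum>i\<in>I. B j i * B k i\<bar>))))"
    (is "_ \<le> ennreal (exp (pi\<^sup>2 / 8 * ?V))")
proof -
  interpret P: prob_space P
    unfolding P_def by (intro prob_space_PiM prob_space_std_normal)
  interpret PP: pair_prob_space P P ..
  interpret PL: pair_sigma_finite "P \<Otimes>\<^sub>M P" lborel ..
  have [measurable_cong]: "sets P = sets (PiM I (\<lambda>_. borel))"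
    unfolding P_def by (intro sets_PiM_cong) simp_all
  define b where "b j z = (\<Sum>i\<in>I. B j i * z i)" for j and z :: "'i \<Rightarrow> real"
  have b_meas [measurable]: "b j \<in> borel_measurable P" for j
    unfolding b_def by measurable
  have g'_meas [measurable]: "g' j \<in> borel_measurable borel" if "j \<in> J" for j
    using g'_cont[OF that] by (rule borel_measurable_continuous_onI)
  \<comment> \<open>With \<open>p\<close> the positions and \<open>q\<close> the velocities of the
    linear forms, \<open>H p q\<close> is the derivative of \<open>F\<close> along the path;
    \<open>pi / 2\<close> rescales the angle to \<open>{0..1}\<close>.\<close>
  define H where "H p q = pi / 2 * (\<Sum>j\<in>J. g' j (p j) * q j)" for p q
  define c where "c u = cos (pi / 2 * u)" for u
  define s where "s u = sin (pi / 2 * u)" for u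
  define a where "a z u = H (\<lambda>j. c u * b j (fst z) + s u * b j (snd z))
      (\<lambda>j. - s u * b j (fst z) + c u * b j (snd z))" for z u
  have c_cont: "continuous_on A c" and s_cont: "continuous_on A s" for A
    unfolding c_def s_def by (intro continuous_intros)+
  have [measurable]: "c \<in> borel_measurable borel" "s \<in> borel_measurable borel"
    using c_cont s_cont by (auto intro: borel_measurable_continuous_onI)
  have path: "ennreal (exp (F (snd z) - F (fst z))) \<le>
      (\<integral>\<^sup>+u. indicator {0..1} u * ennreal (exp (a z u)) \<partial>lborel)" for z
  proof (rule exp_integral_le_nn_integral)
    have cont: "continuous_on {0..1} (\<lambda>u. g' j (c u * b j (fst z) + s u * b j (snd z)))"
      if "j \<in> J" for j
      by (rule continuous_on_compose2[OF g'_cont[OF that]])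
        (auto intro!: continuous_intros c_cont s_cont)
    show "continuous_on {0..1} (a z)"
      unfolding a_def H_def by (intro continuous_intros cont c_cont s_cont)
    have "((\<lambda>u. \<Sum>j\<in>J. g j (c u * b j (fst z) + s u * b j (snd z))) has_real_derivative a z u) (at u)"
      for u
    proof -
      have "((\<lambda>u. c u * b j (fst z) + s u * b j (snd z)) has_real_derivative
          pi / 2 * (- s u * b j (fst z) + c u * b j (snd z))) (at u)" for j
        unfolding c_def s_def by (auto intro!: derivative_eq_intros simp: algebra_simps)
      then have "((\<lambda>u. \<Sum>j\<in>J. g j (c u * b j (fst z) + s u * b j (snd z))) has_real_derivative
          (\<Sum>j\<in>J. g' j (c u * b j (fst z) + s u * b j (snd z)) *
            (pi / 2 * (- s u * b j (fst z) + c u * b j (snd z))))) (at u)"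
        by (intro DERIV_sum DERIV_chain2[OF g])
      then show ?thesis
        by (simp add: a_def H_def sum_distrib_left mult.left_commute)
    qed
    then have "(a z has_integral
        (\<Sum>j\<in>J. g j (c 1 * b j (fst z) + s 1 * b j (snd z))) -
        (\<Sum>j\<in>J. g j (c 0 * b j (fst z) + s 0 * b j (snd z)))) {0..1}"
      by (intro fundamental_theorem_of_calculus)
        (auto simp: has_real_derivative_iff_has_vector_derivative intro: has_vector_derivative_at_within)
    then show "(a z has_integral F (snd z) - F (fst z)) {0..1}"
      by (simp add: c_def s_def F_def b_def)
  qed
  \<comment> \<open>At \<open>u = 1\<close> the path has made a quarter turn and
    \<open>c u = 0\<close>; this endpoint is discarded below as a null set.\<close>
  have mgf: "(\<integral>\<^sup>+z. ennreal (exp (a z u)) \<partial>(P \<Otimes>\<^sub>M P)) \<le> ennreal (exp (pi\<^sup>2 / 8 * ?V))"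
    if u: "u \<in> {0..<1}" for u
  proof -
    have "0 < c u"
      unfolding c_def using u by (intro cos_gt_zero_pi) (auto simp: field_simps intro: less_le_trans[of _ 0])
    define h where "h z = ennreal (exp (H (\<lambda>j. b j (fst z)) (\<lambda>j. b j (snd z))))" for z
    have h [measurable]: "h \<in> borel_measurable (P \<Otimes>\<^sub>M P)"
      unfolding h_def H_def by measurable
    have "(\<integral>\<^sup>+z. ennreal (exp (a z u)) \<partial>(P \<Otimes>\<^sub>M P)) =
        (\<integral>\<^sup>+z. h (\<lambda>i\<in>I. c u * fst z i + s u * snd z i, \<lambda>i\<in>I. - s u * fst z i + c u * snd z i) \<partial>(P \<Otimes>\<^sub>M P))"
      unfolding h_def a_def b_def
      by (simp add: algebra_simps sum.distrib sum_distrib_left sum_subtractf sum_negf)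
    also have "\<dots> = (\<integral>\<^sup>+z. h z \<partial>(P \<Otimes>\<^sub>M P))"
      unfolding P_def
      by (rule nn_integral_PiM_std_normal_rotation[OF I, where f = h and c = "c u" and s = "s u"])
        (use \<open>0 < c u\<close> h in \<open>auto simp: P_def c_def s_def\<close>)
    also have "\<dots> = (\<integral>\<^sup>+x. \<integral>\<^sup>+y. h (x, y) \<partial>P \<partial>P)"
      by (rule P.nn_integral_fst[symmetric]) (rule h)
    also have "\<dots> \<le> (\<integral>\<^sup>+x. ennreal (exp (pi\<^sup>2 / 8 * ?V)) \<partial>P)"
    proof (rule nn_integral_mono)
      fix x
      \<comment> \<open>At a fixed position \<open>x\<close> the derivative is linear in the
        independent velocity \<open>y\<close>, so its exponential moment is explicit. The constant
        \<open>pi\<^sup>2 / 8\<close> is \<open>(pi / 2)\<^sup>2 / 2\<close>.\<close>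
      define d where "d i = pi / 2 * (\<Sum>j\<in>J. g' j (b j x) * B j i)" for i
      have "H (\<lambda>j. b j x) (\<lambda>j. b j y) = (\<Sum>i\<in>I. d i * y i)" for y
      proof -
        have "(\<Sum>j\<in>J. g' j (b j x) * b j y) = (\<Sum>j\<in>J. \<Sum>i\<in>I. g' j (b j x) * B j i * y i)"
          by (simp add: b_def sum_distrib_left mult.assoc)
        also have "\<dots> = (\<Sum>i\<in>I. (\<Sum>j\<in>J. g' j (b j x) * B j i) * y i)"
          by (subst sum.swap) (simp add: sum_distrib_right)
        finally show ?thesis
          unfolding H_def d_def mult.assoc[of "pi / 2"] sum_distrib_left[symmetric] by simp
      qed
      then have "(\<integral>\<^sup>+y. h (x, y) \<partial>P) = ennreal (exp ((\<Sum>i\<in>I. (d i)\<^sup>2) / 2))"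
        unfolding h_def P_def by (simp add: nn_integral_PiM_std_normal_exp[OF I])
      also have "\<dots> \<le> ennreal (exp (pi\<^sup>2 / 8 * ?V))"
      proof -
        have "(\<Sum>i\<in>I. (\<Sum>j\<in>J. g' j (b j x) * B j i)\<^sup>2) =
            (\<Sum>i\<in>I. \<Sum>j\<in>J. \<Sum>k\<in>J. g' j (b j x) * g' k (b k x) * (B j i * B k i))"
          by (simp add: power2_eq_square sum_product algebra_simps)
        also have "\<dots> = (\<Sum>j\<in>J. \<Sum>k\<in>J. \<Sum>i\<in>I. g' j (b j x) * g' k (b k x) * (B j i * B k i))"
          by (subst sum.swap) (intro sum.cong refl sum.swap)
        also have "\<dots> = (\<Sum>j\<in>J. \<Sum>k\<in>J. g' j (b j x) * g' k (b k x) * (\<Sum>i\<in>I. B j i * B k i))"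
          by (simp add: sum_distrib_left)
        \<comment> \<open>Estimating each term separately trades the quadratic form in the
          derivatives for the sum of the absolute entries of the Gram matrix of the rows of
          \<open>B\<close>.\<close>
        also have "\<dots> \<le> (\<Sum>j\<in>J. \<Sum>k\<in>J. L\<^sup>2 * \<bar>\<Sum>i\<in>I. B j i * B k i\<bar>)"
        proof (intro sum_mono)
          fix j k assume jk: "j \<in> J" "k \<in> J"
          have "\<bar>g' j (b j x) * g' k (b k x)\<bar> \<le> L\<^sup>2"
            unfolding abs_mult power2_eq_square
            using g'_bound[OF jk(1), of "b j x"] g'_bound[OF jk(2), of "b k x"]
            by (intro mult_mono) auto
          then have "\<bar>g' j (b j x) * g' k (b k x) * (\<Sum>i\<in>I. B j i * B k i)\<bar> \<le>
              L\<^sup>2 * \<bar>\<Sum>i\<in>I. B j i * B k i\<bar>"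
            by (subst abs_mult) (intro mult_right_mono, auto)
          then show "g' j (b j x) * g' k (b k x) * (\<Sum>i\<in>I. B j i * B k i) \<le>
              L\<^sup>2 * \<bar>\<Sum>i\<in>I. B j i * B k i\<bar>"
            by linarith
        qed
        also have "\<dots> = ?V"
          by (simp add: sum_distrib_left)
        finally have "pi\<^sup>2 / 8 * (\<Sum>i\<in>I. (\<Sum>j\<in>J. g' j (b j x) * B j i)\<^sup>2) \<le> pi\<^sup>2 / 8 * ?V"
          by (rule mult_left_mono) simp
        moreover have "(\<Sum>i\<in>I. (d i)\<^sup>2) / 2 = pi\<^sup>2 / 8 * (\<Sum>i\<in>I. (\<Sum>j\<in>J. g' j (b j x) * B j i)\<^sup>2)"
          unfolding d_def power_mult_distrib sum_distrib_left[symmetric] by (simp add: power_divide)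
        ultimately show ?thesis
          by (simp add: ennreal_leI)
      qed
      finally show "(\<integral>\<^sup>+y. h (x, y) \<partial>P) \<le> ennreal (exp (pi\<^sup>2 / 8 * ?V))" .
    qed
    also have "\<dots> = ennreal (exp (pi\<^sup>2 / 8 * ?V))"
      by (simp add: P.emeasure_space_1)
    finally show ?thesis .
  qed
  have a_meas [measurable]: "(\<lambda>(z, u). a z u) \<in> borel_measurable ((P \<Otimes>\<^sub>M P) \<Otimes>\<^sub>M borel)"
    unfolding a_def H_def split_beta' by measurable
  have "(\<integral>\<^sup>+z. ennreal (exp (F (snd z) - F (fst z))) \<partial>(P \<Otimes>\<^sub>M P)) \<le>
      (\<integral>\<^sup>+z. (\<integral>\<^sup>+u. indicator {0..1} u * ennreal (exp (a z u)) \<partial>lborel) \<partial>(P \<Otimes>\<^sub>M P))"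
    by (intro nn_integral_mono path)
  also have "\<dots> = (\<integral>\<^sup>+u. (\<integral>\<^sup>+z. indicator {0..1} u * ennreal (exp (a z u)) \<partial>(P \<Otimes>\<^sub>M P)) \<partial>lborel)"
    by (rule PL.Fubini'[symmetric]) measurable
  also have "\<dots> \<le> (\<integral>\<^sup>+u. indicator {0..1::real} u * ennreal (exp (pi\<^sup>2 / 8 * ?V)) \<partial>lborel)"
  proof (rule nn_integral_mono_AE)
    show "AE u in lborel. (\<integral>\<^sup>+z. indicator {0..1} u * ennreal (exp (a z u)) \<partial>(P \<Otimes>\<^sub>M P)) \<le>
        indicator {0..1} u * ennreal (exp (pi\<^sup>2 / 8 * ?V))"
      using AE_lborel_singleton[of "1 :: real"]
    proof eventually_elim
      case (elim u)
      then show ?case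
        using mgf[of u] by (cases "u \<in> {0..1}") auto
    qed
  qed
  also have "\<dots> = ennreal (exp (pi\<^sup>2 / 8 * ?V))"
    by (simp add: nn_integral_multc)
  finally show ?thesis .
qed

text \<open>A Chernoff bound in which the mean is replaced by an independent copy: by Jensen
  \<open>exp (- r * m)\<close> is at most the expectation of \<open>exp (- r * F y)\<close>, so the
  centred exponential moment is at most that of \<open>F x - F y\<close>. The bound \<open>K\<close>
  secures integrability.\<close>

lemma std_normal_concentration:
  fixes B :: "'j \<Rightarrow> 'i \<Rightarrow> real" and g g' :: "'j \<Rightarrow> real \<Rightarrow> real" and L K V \<epsilon> :: real
  assumes I: "finite I" and J: "finite J"
    and g: "\<And>j x. j \<in> J \<Longrightarrow> (g j has_real_derivative g' j x) (at x)"
    and g'_cont: "\<And>j. j \<in> J \<Longrightarrow> continuous_on UNIV (g' j)"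
    and g'_bound: "\<And>j x. j \<in> J \<Longrightarrow> \<bar>g' j x\<bar> \<le> L"
    and g_bound: "\<And>j x. j \<in> J \<Longrightarrow> \<bar>g j x\<bar> \<le> K"
    and V: "L\<^sup>2 * (\<Sum>j\<in>J. \<Sum>k\<in>J. \<bar>\<Sum>i\<in>I. B j i * B k i\<bar>) \<le> V" and V_pos: "0 < V" and \<epsilon>: "0 \<le> \<epsilon>"
  defines "P \<equiv> PiM I (\<lambda>_. std_normal_distribution)"
    and "F \<equiv> \<lambda>z. \<Sum>j\<in>J. g j (\<Sum>i\<in>I. B j i * z i)"
  shows "measure P {z \<in> space P. F z - (\<integral>z. F z \<partial>P) \<ge> \<epsilon>} \<le> exp (- 2 * \<epsilon>\<^sup>2 / (pi\<^sup>2 * V))"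
proof -
  interpret P: prob_space P
    unfolding P_def by (intro prob_space_PiM prob_space_std_normal)
  have [measurable_cong]: "sets P = sets (PiM I (\<lambda>_. borel))"
    unfolding P_def by (intro sets_PiM_cong) simp_all
  have [measurable]: "g j \<in> borel_measurable borel" if "j \<in> J" for j
    using g[OF that] by (intro borel_measurable_continuous_onI DERIV_continuous_on) (auto intro: DERIV_subset)
  have F [measurable]: "F \<in> borel_measurable P"
    unfolding F_def by measurable
  have F_bound: "\<bar>F z\<bar> \<le> of_nat (card J) * K" for z
    unfolding F_def using sum_norm_bound[of J "\<lambda>j. g j (\<Sum>i\<in>I. B j i * z i)" K] g_bound by simp
  have F_int: "integrable P F"
    by (rule P.integrable_const_bound[where B = "of_nat (card J) * K"]) (auto simp: F_bound)
  define m where "m = (\<integral>z. F z \<partial>P)"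
  \<comment> \<open>The minimiser of \<open>pi\<^sup>2 / 8 * r\<^sup>2 * V - r * \<epsilon>\<close>.\<close>
  define r where "r = 4 * \<epsilon> / (pi\<^sup>2 * V)"
  have r: "0 \<le> r"
    using V_pos \<epsilon> by (simp add: r_def)
  have "ennreal (exp (r * (- m))) \<le> (\<integral>\<^sup>+y. ennreal (exp (r * (- F y))) \<partial>P)"
  proof -
    \<comment> \<open>The integrand is the tangent to the exponential at \<open>- r * m\<close>,
      taken at \<open>- r * F y\<close>; its expectation is \<open>exp (- r * m)\<close>.\<close>
    have int: "integrable P (\<lambda>y. exp (- r * m) * ((1 + r * m) - r * F y))"
      using F_int by simp
    have int_exp: "integrable P (\<lambda>y. exp (r * (- F y)))"
    proof (rule P.integrable_const_bound[where B = "exp (r * (of_nat (card J) * K))"])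
      have "r * (- F y) \<le> r * (of_nat (card J) * K)" for y
        using F_bound[of y] r by (intro mult_left_mono) auto
      then show "AE y in P. norm (exp (r * (- F y))) \<le> exp (r * (of_nat (card J) * K))"
        by simp
    qed simp
    have "exp (- r * m) = (\<integral>y. exp (- r * m) * ((1 + r * m) - r * F y) \<partial>P)"
      using F_int by (simp add: m_def P.prob_space)
    also have "\<dots> \<le> (\<integral>y. exp (r * (- F y)) \<partial>P)"
    proof (rule integral_mono[OF int int_exp])
      fix y
      have "exp (- r * m) * ((1 + r * m) - r * F y) \<le> exp (- r * m) * exp (r * m - r * F y)"
        using exp_ge_add_one_self[of "r * m - r * F y"] by (intro mult_left_mono) (simp_all add: algebra_simps)
      also have "\<dots> = exp (r * (- F y))"
        by (simp add: exp_add[symmetric])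
      finally show "exp (- r * m) * ((1 + r * m) - r * F y) \<le> exp (r * (- F y))" .
    qed
    finally show ?thesis
      by (subst nn_integral_eq_integral[OF int_exp]) (auto intro: ennreal_leI)
  qed
  then have "(\<integral>\<^sup>+x. ennreal (exp (r * F x)) \<partial>P) * ennreal (exp (r * (- m))) \<le>
      (\<integral>\<^sup>+x. ennreal (exp (r * F x)) \<partial>P) * (\<integral>\<^sup>+y. ennreal (exp (r * (- F y))) \<partial>P)"
    by (rule mult_left_mono) simp
  also have "\<dots> = (\<integral>\<^sup>+x. \<integral>\<^sup>+y. ennreal (exp (r * (- F y))) * ennreal (exp (r * F x)) \<partial>P \<partial>P)"
    by (simp add: nn_integral_multc nn_integral_cmult mult.commute)
  also have "\<dots> = (\<integral>\<^sup>+z. ennreal (exp (r * (- F (snd z)))) * ennreal (exp (r * F (fst z))) \<partial>(P \<Otimes>\<^sub>M P))"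
    by (subst P.nn_integral_fst[symmetric]) simp_all
  \<comment> \<open>The preceding lemma bounds second minus first; the factor \<open>- r\<close>
    turns this into \<open>r\<close> times first minus second.\<close>
  also have "\<dots> = (\<integral>\<^sup>+z. ennreal (exp ((\<Sum>j\<in>J. - r * g j (\<Sum>i\<in>I. B j i * snd z i)) -
      (\<Sum>j\<in>J. - r * g j (\<Sum>i\<in>I. B j i * fst z i)))) \<partial>(P \<Otimes>\<^sub>M P))"
    by (intro nn_integral_cong)
      (simp add: F_def ennreal_mult[symmetric] exp_add[symmetric] sum_distrib_left sum_negf)
  also have "\<dots> \<le> ennreal (exp (pi\<^sup>2 / 8 * ((r * L)\<^sup>2 * (\<Sum>j\<in>J. \<Sum>k\<in>J. \<bar>\<Sum>i\<in>I. B j i * B k i\<bar>))))"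
    unfolding P_def
  proof (rule nn_integral_exp_diff_le[OF I J, where g' = "\<lambda>j x. - r * g' j x"])
    fix j x assume j: "j \<in> J"
    show "((\<lambda>x. - r * g j x) has_real_derivative - r * g' j x) (at x)"
      using g[OF j] by (rule DERIV_cmult)
    show "continuous_on UNIV (\<lambda>x. - r * g' j x)"
      using g'_cont[OF j] by (intro continuous_intros)
    show "\<bar>- r * g' j x\<bar> \<le> r * L"
      using g'_bound[OF j, of x] r by (simp add: abs_mult mult_left_mono)
  qed
  also have "\<dots> \<le> ennreal (exp (pi\<^sup>2 / 8 * (r\<^sup>2 * V)))"
    using V by (auto intro!: ennreal_leI mult_left_mono simp: power_mult_distrib mult.assoc)
  finally have mgf: "(\<integral>\<^sup>+x. ennreal (exp (r * F x)) \<partial>P) * ennreal (exp (r * (- m))) \<le>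
      ennreal (exp (pi\<^sup>2 / 8 * (r\<^sup>2 * V)))" .
  have "emeasure P {z \<in> space P. F z - m \<ge> \<epsilon>} =
      (\<integral>\<^sup>+z. indicator {z \<in> space P. F z - m \<ge> \<epsilon>} z \<partial>P)"
    by simp
  \<comment> \<open>Markov's inequality, in pointwise form.\<close>
  also have "\<dots> \<le> (\<integral>\<^sup>+z. ennreal (exp (r * F z)) * ennreal (exp (r * (- m))) * ennreal (exp (- r * \<epsilon>)) \<partial>P)"
  proof (rule nn_integral_mono)
    fix z
    show "indicator {z \<in> space P. F z - m \<ge> \<epsilon>} z \<le>
        ennreal (exp (r * F z)) * ennreal (exp (r * (- m))) * ennreal (exp (- r * \<epsilon>))"
    proof (cases "F z - m \<ge> \<epsilon>")
      case True
      then have "0 \<le> r * (F z - m - \<epsilon>)"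
        using r by simp
      then have "1 \<le> exp (r * F z) * exp (r * (- m)) * exp (- r * \<epsilon>)"
        unfolding exp_add[symmetric] by (simp add: algebra_simps)
      then show ?thesis
        by (auto simp: ennreal_mult[symmetric] split: split_indicator)
    qed simp
  qed
  also have "\<dots> = (\<integral>\<^sup>+z. ennreal (exp (r * F z)) \<partial>P) * ennreal (exp (r * (- m))) * ennreal (exp (- r * \<epsilon>))"
    by (simp add: nn_integral_multc)
  also have "\<dots> \<le> ennreal (exp (pi\<^sup>2 / 8 * (r\<^sup>2 * V))) * ennreal (exp (- r * \<epsilon>))"
    by (rule mult_right_mono[OF mgf]) simp
  also have "\<dots> = ennreal (exp (- 2 * \<epsilon>\<^sup>2 / (pi\<^sup>2 * V)))"
  proof -
    have "pi\<^sup>2 / 8 * (r\<^sup>2 * V) + - r * \<epsilon> = - 2 * \<epsilon>\<^sup>2 / (pi\<^sup>2 * V)"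
      using V_pos by (simp add: r_def power2_eq_square field_simps)
    then show ?thesis
      by (simp only: ennreal_mult[symmetric] exp_ge_zero exp_add[symmetric])
  qed
  finally show ?thesis
    unfolding m_def P.emeasure_eq_measure by (subst (asm) ennreal_le_iff) auto
qed

section \<open>Smooth approximation of indicators\<close>

text \<open>The theorem on sums of independent normal variables asks for positive standard
  deviations, so zero coefficients are dropped first. Some coefficient remains, as the squares add
  up to one.\<close>

lemma distributed_linear_form_std_normal:
  fixes b :: "'i \<Rightarrow> real"
  assumes I: "finite I" and b: "(\<Sum>i\<in>I. (b i)\<^sup>2) = 1"
  shows "distributed (PiM I (\<lambda>_. std_normal_distribution)) lborel (\<lambda>z. \<Sum>i\<in>I. b i * z i) std_normal_density"
proof -
  let ?P = "PiM I (\<lambda>_. std_normal_distribution)"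
  interpret P: prob_space ?P
    by (intro prob_space_PiM prob_space_std_normal)
  define K where "K = {i\<in>I. b i \<noteq> 0}"
  have K: "finite K" "K \<subseteq> I"
    using I by (auto simp: K_def)
  have "K \<noteq> {}"
  proof
    assume "K = {}"
    then have "(\<Sum>i\<in>I. (b i)\<^sup>2) = 0"
      by (intro sum.neutral) (auto simp: K_def)
    with b show False by simp
  qed
  have coord: "distr ?P std_normal_distribution (\<lambda>z. z i) = std_normal_distribution" if "i \<in> I" for i
    using distr_PiM_component[of I "\<lambda>_. std_normal_distribution", OF prob_space_std_normal that] .
  have "P.indep_vars (\<lambda>_. std_normal_distribution) (\<lambda>i z. z i) I"
  proof (subst P.indep_vars_iff_distr_eq_PiM')
    show "I \<noteq> {}" using K \<open>K \<noteq> {}\<close> by auto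
    have "distr ?P ?P (\<lambda>z. \<lambda>i\<in>I. z i) = distr ?P ?P (\<lambda>z. z)"
      by (intro distr_cong) (auto simp: space_PiM PiE_def extensional_restrict)
    then show "distr ?P ?P (\<lambda>z. \<lambda>i\<in>I. z i) = PiM I (\<lambda>i. distr ?P std_normal_distribution (\<lambda>z. z i))"
      by (simp add: distr_id2 coord cong: PiM_cong)
  qed (auto intro: measurable_component_singleton)
  then have "P.indep_vars (\<lambda>_. std_normal_distribution) (\<lambda>i z. z i) K"
    using K(2) by (rule P.indep_vars_subset)
  then have ind: "P.indep_vars (\<lambda>_. borel) (\<lambda>i z. b i * z i) K"
    by (rule P.indep_vars_compose2) simp
  have "distributed ?P lborel (\<lambda>z. \<Sum>i\<in>K. b i * z i)
      (normal_density (\<Sum>i\<in>K. 0) (sqrt (\<Sum>i\<in>K. \<bar>b i\<bar>\<^sup>2)))"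
  proof (rule P.sum_indep_normal[OF K(1) \<open>K \<noteq> {}\<close> ind])
    fix i assume i: "i \<in> K"
    then have bi: "b i \<noteq> 0" by (simp add: K_def)
    show "0 < \<bar>b i\<bar>" using bi by simp
    have "(\<lambda>z. z i) \<in> measurable ?P std_normal_distribution"
      using i K by (intro measurable_component_singleton) auto
    then have meas: "(\<lambda>z. z i) \<in> measurable ?P lborel"
      by (subst measurable_cong_sets[OF refl, where N' = std_normal_distribution]) (simp_all del: measurable_std_normal)
    have "distr ?P lborel (\<lambda>z. z i) = distr ?P std_normal_distribution (\<lambda>z. z i)"
      by (rule distr_cong) auto
    then have "distributed ?P lborel (\<lambda>z. z i) std_normal_density"
      using coord[of i] i K meas unfolding distributed_def by auto
    from P.normal_density_affine[OF this, of "b i" 0] bi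
    show "distributed ?P lborel (\<lambda>z. b i * z i) (normal_density 0 \<bar>b i\<bar>)"
      by simp
  qed
  moreover have "(\<Sum>i\<in>K. \<bar>b i\<bar>\<^sup>2) = (\<Sum>i\<in>I. (b i)\<^sup>2)"
    unfolding K_def using I by (simp, intro sum.mono_neutral_left) auto
  moreover have "(\<Sum>i\<in>K. b i * z i) = (\<Sum>i\<in>I. b i * z i)" for z
    unfolding K_def using I by (intro sum.mono_neutral_left) auto
  ultimately show ?thesis
    by (simp add: b)
qed

lemma std_normal_density_le_half: "std_normal_density x \<le> 1 / 2"
proof -
  have "2 \<le> sqrt (2 * pi)"
    using pi_gt3 by (intro real_le_rsqrt) simp
  then have "1 / sqrt (2 * pi) \<le> 1 / 2"
    by (intro divide_left_mono) auto
  moreover have "1 / sqrt (2 * pi) * exp (- (x\<^sup>2) / 2) \<le> 1 / sqrt (2 * pi) * 1"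
    by (intro mult_left_mono) auto
  ultimately have "1 / sqrt (2 * pi) * exp (- (x\<^sup>2) / 2) \<le> 1 / 2"
    by linarith
  then show ?thesis
    unfolding std_normal_density_def .
qed

text \<open>The density is at most \<open>1 / 2\<close> and the interval has length
  \<open>2 * e\<close>. This is the price of smoothing an indicator near its threshold.\<close>

lemma std_normal_small_ball:
  fixes b :: "'i \<Rightarrow> real"
  assumes I: "finite I" and b: "(\<Sum>i\<in>I. (b i)\<^sup>2) = 1" and e: "0 \<le> e"
  shows "(\<integral>z. indicator {c - e..c + e} (\<Sum>i\<in>I. b i * z i) \<partial>PiM I (\<lambda>_. std_normal_distribution)) \<le> e"
proof -
  let ?P = "PiM I (\<lambda>_. std_normal_distribution)"
  interpret P: prob_space ?P
    by (intro prob_space_PiM prob_space_std_normal)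
  have D: "distributed ?P lborel (\<lambda>z. \<Sum>i\<in>I. b i * z i) std_normal_density"
    by (rule distributed_linear_form_std_normal[OF I b])
  note [measurable] = distributed_measurable[OF D, simplified]
  have "(\<integral>\<^sup>+z. ennreal (indicator {c - e..c + e} (\<Sum>i\<in>I. b i * z i)) \<partial>?P) =
      (\<integral>\<^sup>+x. ennreal (std_normal_density x) * ennreal (indicator {c - e..c + e} x) \<partial>lborel)"
    by (rule distributed_nn_integral[OF D, symmetric]) simp
  also have "\<dots> \<le> (\<integral>\<^sup>+x. ennreal (1 / 2) * indicator {c - e..c + e} x \<partial>lborel)"
  proof (rule nn_integral_mono)
    fix x
    show "ennreal (std_normal_density x) * ennreal (indicator {c - e..c + e} x) \<le>
        ennreal (1 / 2) * indicator {c - e..c + e} x"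
      using ennreal_leI[OF std_normal_density_le_half[of x]] by (cases "x \<in> {c - e..c + e}") simp_all
  qed
  also have "\<dots> = ennreal (1 / 2) * ennreal (2 * e)"
    using e by (simp add: nn_integral_cmult)
  also have "\<dots> = ennreal e"
    using e by (subst ennreal_mult[symmetric]) auto
  finally show ?thesis
    using e by (intro integral_real_bounded) simp_all
qed

section \<open>Continuously differentiable ramps\<close>

text \<open>The class to which concentration applies: \<open>L\<close> enters the exponent,
  \<open>K\<close> secures integrability. The derivative is hidden behind an existential so that
  functions can be combined without carrying it along.\<close>

definition smooth_bounded :: "real \<Rightarrow> real \<Rightarrow> (real \<Rightarrow> real) \<Rightarrow> bool" where
  "smooth_bounded K L g \<longleftrightarrow>
     (\<exists>g'. (\<forall>x. (g has_real_derivative g' x) (at x)) \<and> continuous_on UNIV g' \<and> (\<forall>x. \<bar>g' x\<bar> \<le> L)) \<and>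
     (\<forall>x. \<bar>g x\<bar> \<le> K)"

lemma smooth_boundedI:
  assumes "\<And>x. (g has_real_derivative g' x) (at x)" "continuous_on UNIV g'"
    "\<And>x. \<bar>g' x\<bar> \<le> L" "\<And>x. \<bar>g x\<bar> \<le> K"
  shows "smooth_bounded K L g"
  using assms unfolding smooth_bounded_def by blast

lemma smooth_boundedE:
  assumes "smooth_bounded K L g"
  obtains g' where "\<And>x. (g has_real_derivative g' x) (at x)" "continuous_on UNIV g'"
    "\<And>x. \<bar>g' x\<bar> \<le> L" "\<And>x. \<bar>g x\<bar> \<le> K"
proof -
  obtain g' where "\<forall>x. (g has_real_derivative g' x) (at x)" "continuous_on UNIV g'"
    "\<forall>x. \<bar>g' x\<bar> \<le> L"
    using assms unfolding smooth_bounded_def by blast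
  moreover have "\<forall>x. \<bar>g x\<bar> \<le> K"
    using assms unfolding smooth_bounded_def by blast
  ultimately show thesis
    by (intro that[of g']) auto
qed

lemma smooth_bounded_const:
  "\<bar>c\<bar> \<le> K \<Longrightarrow> 0 \<le> L \<Longrightarrow> smooth_bounded K L (\<lambda>_. c)"
  by (rule smooth_boundedI[of _ "\<lambda>_. 0"]) auto

lemma smooth_bounded_cmult:
  assumes "smooth_bounded K L g"
  shows "smooth_bounded (\<bar>c\<bar> * K) (\<bar>c\<bar> * L) (\<lambda>x. c * g x)"
  using assms
proof (rule smooth_boundedE)
  fix g'
  assume g: "\<And>x. (g has_real_derivative g' x) (at x)" "continuous_on UNIV g'"
    "\<And>x. \<bar>g' x\<bar> \<le> L" "\<And>x. \<bar>g x\<bar> \<le> K"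
  show ?thesis
    by (rule smooth_boundedI[of _ "\<lambda>x. c * g' x"])
      (use g in \<open>auto intro!: DERIV_cmult continuous_intros mult_left_mono simp: abs_mult\<close>)
qed

lemma smooth_bounded_diff:
  assumes "smooth_bounded K L g" "smooth_bounded K2 L2 h"
  shows "smooth_bounded (K + K2) (L + L2) (\<lambda>x. g x - h x)"
proof -
  obtain g' where g: "\<And>x. (g has_real_derivative g' x) (at x)" "continuous_on UNIV g'"
    "\<And>x. \<bar>g' x\<bar> \<le> L" "\<And>x. \<bar>g x\<bar> \<le> K"
    using smooth_boundedE[OF assms(1)] by blast
  obtain h' where h: "\<And>x. (h has_real_derivative h' x) (at x)" "continuous_on UNIV h'"
    "\<And>x. \<bar>h' x\<bar> \<le> L2" "\<And>x. \<bar>h x\<bar> \<le> K2"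
    using smooth_boundedE[OF assms(2)] by blast
  show ?thesis
  proof (rule smooth_boundedI[of _ "\<lambda>x. g' x - h' x"])
    fix x
    show "((\<lambda>x. g x - h x) has_real_derivative g' x - h' x) (at x)"
      by (intro DERIV_diff g h)
    show "\<bar>g' x - h' x\<bar> \<le> L + L2" "\<bar>g x - h x\<bar> \<le> K + K2"
      using g(3)[of x] g(4)[of x] h(3)[of x] h(4)[of x] by linarith+
  qed (intro continuous_intros g h)
qed

text \<open>The derivative is the tent over \<open>{0..1}\<close> with peak \<open>2\<close> at
  \<open>1 / 2\<close>, hence of area one. Squared positive parts are continuously differentiable,
  so a single formula serves the whole line and no pieces have to be glued.\<close>

definition smooth_step :: "real \<Rightarrow> real" where
  "smooth_step u = 2 * (max 0 u)\<^sup>2 - 4 * (max 0 (u - 1 / 2))\<^sup>2 + 2 * (max 0 (u - 1))\<^sup>2"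

lemma DERIV_positive_part_squared:
  "((\<lambda>u::real. (max 0 u)\<^sup>2) has_real_derivative 2 * max 0 x) (at x)"
proof -
  consider "x < 0" | "x = 0" | "x > 0" by linarith
  then show ?thesis
  proof cases
    case 1
    have "((\<lambda>u::real. 0) has_real_derivative 0) (at x)" by simp
    then have "((\<lambda>u::real. (max 0 u)\<^sup>2) has_real_derivative 0) (at x)"
      by (rule has_field_derivative_transform_within_open[where S = "{..<0}"]) (use 1 in auto)
    then show ?thesis using 1 by simp
  next
    case 2
    have "((\<lambda>h::real. max 0 h) \<longlongrightarrow> 0) (at 0)"
      by (auto intro!: tendsto_eq_intros)
    \<comment> \<open>For \<open>h \<noteq> 0\<close> the difference quotient is
      \<open>max 0 h\<close> itself.\<close>
    then have "((\<lambda>h::real. (max 0 h)\<^sup>2 / h) \<longlongrightarrow> 0) (at 0)"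
      by (rule Lim_transform_eventually)
        (auto simp: eventually_at_filter max_def power2_eq_square)
    then show ?thesis using 2 by (simp add: DERIV_def)
  next
    case 3
    have "((\<lambda>u::real. u\<^sup>2) has_real_derivative 2 * x) (at x)"
      by (auto intro!: derivative_eq_intros)
    then have "((\<lambda>u::real. (max 0 u)\<^sup>2) has_real_derivative 2 * x) (at x)"
      by (rule has_field_derivative_transform_within_open[where S = "{0<..}"]) (use 3 in auto)
    then show ?thesis using 3 by simp
  qed
qed

definition smooth_step_deriv :: "real \<Rightarrow> real" where
  "smooth_step_deriv u = 4 * max 0 u - 8 * max 0 (u - 1 / 2) + 4 * max 0 (u - 1)"

lemma DERIV_smooth_step: "(smooth_step has_real_derivative smooth_step_deriv x) (at x)"
proof -
  have "((\<lambda>u. (max 0 (u - c))\<^sup>2) has_real_derivative 2 * max 0 (x - c)) (at x)" for c :: real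
  proof -
    have "((\<lambda>u. u - c) has_real_derivative 1) (at x)"
      by (auto intro!: derivative_eq_intros)
    from DERIV_chain2[where f = "\<lambda>u. (max 0 u)\<^sup>2" and g = "\<lambda>u. u - c",
      OF DERIV_positive_part_squared this]
    show ?thesis by simp
  qed
  note D = this[of 0] this[of "1 / 2"] this[of 1]
  have "((\<lambda>u. 2 * (max 0 (u - 0))\<^sup>2 - 4 * (max 0 (u - 1 / 2))\<^sup>2 + 2 * (max 0 (u - 1))\<^sup>2)
      has_real_derivative 2 * (2 * max 0 (x - 0)) - 4 * (2 * max 0 (x - 1 / 2)) + 2 * (2 * max 0 (x - 1))) (at x)"
    by (intro DERIV_add DERIV_diff DERIV_cmult D)
  then show ?thesis
    by (simp add: smooth_step_def[abs_def] smooth_step_deriv_def)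
qed

lemma smooth_step_deriv_bounds: "0 \<le> smooth_step_deriv u" "smooth_step_deriv u \<le> 2"
  by (auto simp: smooth_step_deriv_def max_def)

lemma continuous_on_smooth_step_deriv: "continuous_on A smooth_step_deriv"
  unfolding smooth_step_deriv_def[abs_def] by (intro continuous_intros)

lemma smooth_step_0: "u \<le> 0 \<Longrightarrow> smooth_step u = 0"
  by (simp add: smooth_step_def)

lemma smooth_step_1: "1 \<le> u \<Longrightarrow> smooth_step u = 1"
  by (simp add: smooth_step_def max_def power2_eq_square algebra_simps)

lemma smooth_step_mono: "u \<le> w \<Longrightarrow> smooth_step u \<le> smooth_step w"
  by (rule DERIV_nonneg_imp_nondecreasing) (use DERIV_smooth_step smooth_step_deriv_bounds in blast)+

lemma smooth_step_bounds: "0 \<le> smooth_step u" "smooth_step u \<le> 1"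
  using smooth_step_mono[of "min u 0" u] smooth_step_mono[of u "max u 1"]
  by (simp_all add: smooth_step_0 smooth_step_1)

lemma smooth_bounded_step:
  assumes "0 < e"
  shows "smooth_bounded 1 (2 / e) (\<lambda>x. smooth_step ((x - c) / e))"
proof (rule smooth_boundedI[of _ "\<lambda>x. smooth_step_deriv ((x - c) / e) * (1 / e)"])
  fix x
  show "((\<lambda>x. smooth_step ((x - c) / e)) has_real_derivative smooth_step_deriv ((x - c) / e) * (1 / e)) (at x)"
    by (rule DERIV_chain2[OF DERIV_smooth_step]) (use assms in \<open>auto intro!: derivative_eq_intros\<close>)
  show "\<bar>smooth_step_deriv ((x - c) / e) * (1 / e)\<bar> \<le> 2 / e"
    using smooth_step_deriv_bounds[of "(x - c) / e"] assms by (simp add: abs_mult divide_right_mono)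
  show "\<bar>smooth_step ((x - c) / e)\<bar> \<le> 1"
    using smooth_step_bounds[of "(x - c) / e"] by simp
next
  show "continuous_on UNIV (\<lambda>x. smooth_step_deriv ((x - c) / e) * (1 / e))"
    by (intro continuous_intros continuous_on_compose2[OF continuous_on_smooth_step_deriv[of UNIV]])
      (use assms in auto)
qed

section \<open>Sandwiching indicators of up-sets\<close>

text \<open>Half-lines without reference to an endpoint: open and closed ones, the empty set and the
  whole line are treated alike, so it never matters whether the threshold itself belongs to the
  set.\<close>

definition up_closed :: "real set \<Rightarrow> bool" where
  "up_closed U \<longleftrightarrow> (\<forall>x\<in>U. \<forall>y\<ge>x. y \<in> U)"

text \<open>Both bounds are the same ramp of width \<open>e\<close>, rising to the right of the
  endpoint for \<open>lo\<close> and to its left for \<open>up\<close>, so they differ only within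
  \<open>e\<close> of it. Trivial sets have no endpoint; the last clause gives them gap zero, as is
  needed for components of zero variance.\<close>

lemma up_closed_sandwich:
  assumes U: "up_closed U" and e: "0 < e"
  obtains lo up c where "smooth_bounded 1 (2 / e) lo" "smooth_bounded 1 (2 / e) up"
    "\<And>x. lo x \<le> indicator U x" "\<And>x. indicator U x \<le> up x"
    "\<And>x. up x - lo x \<le> indicator {c - e..c + e} x"
    "U = {} \<or> U = UNIV \<Longrightarrow> up = lo"
proof (cases "U = {} \<or> U = UNIV")
  case True
  then obtain d :: real where d: "\<And>x. indicator U x = d" "\<bar>d\<bar> \<le> 1"
    by (cases "U = {}") (auto intro: that[of 0] that[of 1])
  then show ?thesis
    using e by (intro that[of "\<lambda>_. d" "\<lambda>_. d"]) (auto intro: smooth_bounded_const)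
next
  case False
  then obtain a b where a: "a \<notin> U" and b: "b \<in> U" by auto
  have bdd: "bdd_below U"
    using U a unfolding up_closed_def by (intro bdd_belowI[of _ a]) (meson linear)
  define c where "c = Inf U"
  have below: "x \<notin> U" if "x < c" for x
    using that cInf_lower[OF _ bdd, of x] by (auto simp: c_def)
  have above: "x \<in> U" if "c < x" for x
  proof -
    have "U \<noteq> {}" "Inf U < x"
      using b that by (auto simp: c_def)
    then have "\<exists>y\<in>U. y < x"
      by (rule cInf_lessD)
    then show ?thesis
      using U by (auto simp: up_closed_def)
  qed
  show ?thesis
  proof (rule that[of "\<lambda>x. smooth_step ((x - c) / e)" "\<lambda>x. smooth_step ((x - (c - e)) / e)" c])
    fix x
    show "smooth_step ((x - c) / e) \<le> indicator U x"
    proof (cases "c < x")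
      case True
      then show ?thesis
        using above[of x] smooth_step_bounds[of "(x - c) / e"] by simp
    next
      case False
      then have "smooth_step ((x - c) / e) = 0"
        using e by (intro smooth_step_0 divide_nonpos_pos) auto
      then show ?thesis by simp
    qed
    show "indicator U x \<le> smooth_step ((x - (c - e)) / e)"
    proof (cases "x < c")
      case True
      then show ?thesis
        using below[of x] smooth_step_bounds[of "(x - (c - e)) / e"] by simp
    next
      case False
      then have "smooth_step ((x - (c - e)) / e) = 1"
        using e by (intro smooth_step_1) (simp add: field_simps)
      then show ?thesis by (simp split: split_indicator)
    qed
    show "smooth_step ((x - (c - e)) / e) - smooth_step ((x - c) / e) \<le> indicator {c - e..c + e} x"
    proof -
      consider "x < c - e" | "x > c + e" | "x \<in> {c - e..c + e}" by fastforce
      then show ?thesis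
      proof cases
        case 1
        then have "(x - (c - e)) / e \<le> 0" "(x - c) / e \<le> 0"
          using e by (intro divide_nonpos_pos; linarith)+
        then show ?thesis by (simp add: smooth_step_0)
      next
        case 2
        then have "1 \<le> (x - (c - e)) / e" "1 \<le> (x - c) / e"
          using e by (simp_all add: field_simps)
        then show ?thesis by (simp add: smooth_step_1)
      next
        case 3
        then show ?thesis
          using smooth_step_bounds[of "(x - (c - e)) / e"] smooth_step_bounds[of "(x - c) / e"] by simp
      qed
    qed
  qed (use e False in \<open>auto intro: smooth_bounded_step\<close>)
qed

section \<open>Rejection regions of the p-values\<close>

lemma std_normal_cdf_mono: "x \<le> y \<Longrightarrow> \<Phi> x \<le> \<Phi> y"
proof -
  interpret real_distribution std_normal_distribution
    by (rule real_dist_normal_dist)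
  assume "x \<le> y"
  then show ?thesis
    unfolding std_normal_cdf_def by (rule cdf_nondecreasing)
qed

lemma pvalue_measurable:
  assumes "p = one_sided_pvalue \<or> p = two_sided_pvalue"
  shows "p \<in> borel_measurable borel"
proof -
  have [measurable]: "\<Phi> \<in> borel_measurable borel"
    by (rule borel_measurable_mono) (simp add: mono_def std_normal_cdf_mono)
  have "(\<lambda>z. 1 - \<Phi> z) \<in> borel_measurable borel" "(\<lambda>z. 2 * \<Phi> (- \<bar>z\<bar>)) \<in> borel_measurable borel"
    by measurable
  with assms show ?thesis
    by (auto simp: one_sided_pvalue_def[abs_def] two_sided_pvalue_def[abs_def])
qed

text \<open>
  The two-sided rejection region is an up-set together with a down-set; the latter enters through
  its complement \<open>V\<close>, so that only up-sets have to be smoothed.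
\<close>

definition threshold_ind :: "real set \<Rightarrow> real set \<Rightarrow> real \<Rightarrow> real" where
  "threshold_ind U V x = indicator U x + 1 - indicator V x"

text \<open>Both p-values are antitone, in \<open>x\<close> or in \<open>\<bar>x\<bar>\<close>,
  because \<open>\<Phi>\<close> is monotone; this alone determines the shape of the region.\<close>

lemma pvalue_threshold_ind:
  assumes "p = one_sided_pvalue \<or> p = two_sided_pvalue"
  obtains U V where "up_closed U" "up_closed V"
    "\<And>x. (if p x \<le> t then 1 else 0) = threshold_ind U V x"
  using assms
proof
  assume p: "p = one_sided_pvalue"
  show ?thesis
  \<comment> \<open>With \<open>V = UNIV\<close> the last two terms of \<open>threshold_ind\<close>
    cancel.\<close>
  proof (rule that[of "{x. p x \<le> t}" UNIV])
    show "up_closed {x. p x \<le> t}"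
      unfolding up_closed_def p one_sided_pvalue_def using std_normal_cdf_mono by fastforce
  qed (auto simp: up_closed_def threshold_ind_def)
next
  assume p: "p = two_sided_pvalue"
  have less: "p y \<le> p x" if "\<bar>x\<bar> \<le> \<bar>y\<bar>" for x y
    using that std_normal_cdf_mono[of "- \<bar>y\<bar>" "- \<bar>x\<bar>"] by (simp add: p two_sided_pvalue_def)
  show ?thesis
  \<comment> \<open>Zero is counted in the first set only, so the two halves are disjoint and
    \<open>threshold_ind\<close> stays in \<open>{0, 1}\<close>.\<close>
  proof (rule that[of "{x. 0 \<le> x \<and> p x \<le> t}" "- {x. x < 0 \<and> p x \<le> t}"])
    show "up_closed {x. 0 \<le> x \<and> p x \<le> t}"
      unfolding up_closed_def
    proof (intro ballI allI impI)
      fix x y assume "x \<in> {x. 0 \<le> x \<and> p x \<le> t}" "x \<le> y"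
      then show "y \<in> {x. 0 \<le> x \<and> p x \<le> t}"
        using less[of x y] by auto
    qed
    show "up_closed (- {x. x < 0 \<and> p x \<le> t})"
      unfolding up_closed_def
    proof (intro ballI allI impI)
      fix x y assume "x \<in> - {x. x < 0 \<and> p x \<le> t}" "x \<le> y"
      then show "y \<in> - {x. x < 0 \<and> p x \<le> t}"
        using less[of y x] by auto
    qed
  qed (auto simp: threshold_ind_def split: split_indicator)
qed

text \<open>Moves offset and scale into the set, so that the ramps live on the scale of the
  standardised variable. For \<open>\<beta> = 0\<close> the preimage is empty or everything.\<close>

lemma up_closed_affine_vimage:
  assumes "up_closed U" "0 \<le> \<beta>"
  shows "up_closed {x. \<alpha> + \<beta> * x \<in> U}"
  unfolding up_closed_def
proof (intro ballI allI impI)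
  fix x y assume "x \<in> {x. \<alpha> + \<beta> * x \<in> U}" "x \<le> y"
  then have "\<alpha> + \<beta> * x \<in> U" "\<alpha> + \<beta> * x \<le> \<alpha> + \<beta> * y"
    using assms(2) by (auto intro: mult_left_mono)
  then show "y \<in> {x. \<alpha> + \<beta> * x \<in> U}"
    using assms(1) by (auto simp: up_closed_def)
qed

text \<open>\<open>V\<close> enters negatively, so the lower bound for \<open>U\<close> is paired
  with the upper bound for \<open>V\<close> and conversely. Two ramps of slope at most
  \<open>2 / e\<close> give \<open>4 / e\<close>, and three terms of size at most one give
  \<open>3\<close>.\<close>

lemma threshold_ind_sandwich:
  assumes U: "up_closed U" and V: "up_closed V" and e: "0 < e" and \<beta>: "0 \<le> \<beta>"
  shows "\<exists>lo up c d. smooth_bounded 3 (4 / e) lo \<and> smooth_bounded 3 (4 / e) up \<and>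
    (\<forall>x. lo x \<le> threshold_ind U V (\<alpha> + \<beta> * x)) \<and> (\<forall>x. threshold_ind U V (\<alpha> + \<beta> * x) \<le> up x) \<and>
    (\<forall>x. up x - lo x \<le> indicator {c - e..c + e} x + indicator {d - e..d + e} x) \<and> (\<beta> = 0 \<longrightarrow> up = lo)"
proof -
  let ?U = "{x. \<alpha> + \<beta> * x \<in> U}" and ?V = "{x. \<alpha> + \<beta> * x \<in> V}"
  obtain lo up c where U': "smooth_bounded 1 (2 / e) lo" "smooth_bounded 1 (2 / e) up"
    "\<And>x. lo x \<le> indicator ?U x" "\<And>x. indicator ?U x \<le> up x"
    "\<And>x. up x - lo x \<le> indicator {c - e..c + e} x" "?U = {} \<or> ?U = UNIV \<Longrightarrow> up = lo"
    using up_closed_sandwich[OF up_closed_affine_vimage[OF U \<beta>] e] by blast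
  obtain lo2 up2 d where V': "smooth_bounded 1 (2 / e) lo2" "smooth_bounded 1 (2 / e) up2"
    "\<And>x. lo2 x \<le> indicator ?V x" "\<And>x. indicator ?V x \<le> up2 x"
    "\<And>x. up2 x - lo2 x \<le> indicator {d - e..d + e} x" "?V = {} \<or> ?V = UNIV \<Longrightarrow> up2 = lo2"
    using up_closed_sandwich[OF up_closed_affine_vimage[OF V \<beta>] e] by blast
  have one: "smooth_bounded 1 0 (\<lambda>_. 1)"
    by (rule smooth_bounded_const) auto
  have f: "threshold_ind U V (\<alpha> + \<beta> * x) = indicator ?U x - (indicator ?V x - 1)" for x
    by (simp add: threshold_ind_def indicator_def)
  show ?thesis
  proof (rule exI[of _ "\<lambda>x. lo x - (up2 x - 1)"], rule exI[of _ "\<lambda>x. up x - (lo2 x - 1)"],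
      rule exI[of _ c], rule exI[of _ d], intro conjI allI impI)
    show "smooth_bounded 3 (4 / e) (\<lambda>x. lo x - (up2 x - 1))"
      using smooth_bounded_diff[OF U'(1) smooth_bounded_diff[OF V'(2) one]] by simp
    show "smooth_bounded 3 (4 / e) (\<lambda>x. up x - (lo2 x - 1))"
      using smooth_bounded_diff[OF U'(2) smooth_bounded_diff[OF V'(1) one]] by simp
    fix x
    show "lo x - (up2 x - 1) \<le> threshold_ind U V (\<alpha> + \<beta> * x)"
      "threshold_ind U V (\<alpha> + \<beta> * x) \<le> up x - (lo2 x - 1)"
      unfolding f using U'(3,4)[of x] V'(3,4)[of x] by linarith+
    show "up x - (lo2 x - 1) - (lo x - (up2 x - 1)) \<le> indicator {c - e..c + e} x + indicator {d - e..d + e} x"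
      using U'(5)[of x] V'(5)[of x] by linarith
  next
    assume "\<beta> = 0"
    then have "?U = {} \<or> ?U = UNIV" "?V = {} \<or> ?V = UNIV"
      by auto
    then show "(\<lambda>x. up x - (lo2 x - 1)) = (\<lambda>x. lo x - (up2 x - 1))"
      using U'(6) V'(6) by simp
  qed
qed

section \<open>Concentration of sums of threshold indicators\<close>

lemma smooth_bounded_concentration:
  fixes B :: "'j \<Rightarrow> 'i \<Rightarrow> real" and g :: "'j \<Rightarrow> real \<Rightarrow> real" and L K V \<epsilon> :: real
  assumes I: "finite I" and J: "finite J"
    and g: "\<And>j. j \<in> J \<Longrightarrow> smooth_bounded K L (g j)"
    and V: "L\<^sup>2 * (\<Sum>j\<in>J. \<Sum>k\<in>J. \<bar>\<Sum>i\<in>I. B j i * B k i\<bar>) \<le> V" "0 < V" and \<epsilon>: "0 \<le> \<epsilon>"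
  defines "P \<equiv> PiM I (\<lambda>_. std_normal_distribution)"
    and "F \<equiv> \<lambda>z. \<Sum>j\<in>J. g j (\<Sum>i\<in>I. B j i * z i)"
  shows "measure P {z \<in> space P. F z - (\<integral>z. F z \<partial>P) \<ge> \<epsilon>} \<le> exp (- 2 * \<epsilon>\<^sup>2 / (pi\<^sup>2 * V))"
proof -
  have "\<forall>j\<in>J. \<exists>g'. (\<forall>x. (g j has_real_derivative g' x) (at x)) \<and> continuous_on UNIV g' \<and> (\<forall>x. \<bar>g' x\<bar> \<le> L)"
    using g unfolding smooth_bounded_def by blast
  then obtain g' where g': "\<And>j. j \<in> J \<Longrightarrow> (\<forall>x. (g j has_real_derivative g' j x) (at x)) \<and>
      continuous_on UNIV (g' j) \<and> (\<forall>x. \<bar>g' j x\<bar> \<le> L)"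
    by metis
  show ?thesis
    unfolding P_def F_def
    by (rule std_normal_concentration[OF I J _ _ _ _ V \<epsilon>, where g' = g' and K = K])
      (use g' g in \<open>auto simp: smooth_bounded_def\<close>)
qed

lemma smooth_bounded_measurable: "smooth_bounded K L g \<Longrightarrow> g \<in> borel_measurable borel"
  by (erule smooth_boundedE, intro borel_measurable_continuous_onI DERIV_continuous_on)
    (auto intro: DERIV_subset)

text \<open>The deviation \<open>3 * e\<close> is split into \<open>e\<close> for the fluctuation of
  the smooth bounds and \<open>2 * e\<close> for the gap between their means, one small ball of
  probability at most \<open>e\<close> for each of the two thresholds. A term with
  \<open>\<beta> j = 0\<close> is constant and has no gap.\<close>

lemma threshold_sum_concentration:
  fixes B :: "'j \<Rightarrow> 'i \<Rightarrow> real" and \<alpha> \<beta> :: "'j \<Rightarrow> real" and e n W :: real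
  assumes I: "finite I" and J: "finite J"
    and U: "up_closed U" and V: "up_closed V"
    and f_meas [measurable]: "threshold_ind U V \<in> borel_measurable borel"
    and \<beta>: "\<And>j. j \<in> J \<Longrightarrow> 0 \<le> \<beta> j"
    and B: "\<And>j. j \<in> J \<Longrightarrow> \<beta> j = 0 \<or> (\<Sum>i\<in>I. (B j i)\<^sup>2) = 1"
    and n: "0 < n" "card J \<le> n" and e: "0 < e"
    and W: "(4 / (e * n))\<^sup>2 * (\<Sum>j\<in>J. \<Sum>k\<in>J. \<bar>\<Sum>i\<in>I. B j i * B k i\<bar>) \<le> W" "0 < W"
  defines "P \<equiv> PiM I (\<lambda>_. std_normal_distribution)"
    and "T \<equiv> \<lambda>z. \<Sum>j\<in>J. threshold_ind U V (\<alpha> j + \<beta> j * (\<Sum>i\<in>I. B j i * z i))"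
  shows "measure P {z \<in> space P. \<bar>T z - (\<integral>z. T z \<partial>P)\<bar> / n \<ge> 3 * e} \<le> 2 * exp (- 2 * e\<^sup>2 / (pi\<^sup>2 * W))"
proof -
  interpret P: prob_space P
    unfolding P_def by (intro prob_space_PiM prob_space_std_normal)
  have [measurable_cong]: "sets P = sets (PiM I (\<lambda>_. borel))"
    unfolding P_def by (intro sets_PiM_cong) simp_all
  define Q where "Q j lo up c d \<longleftrightarrow> smooth_bounded 3 (4 / e) lo \<and> smooth_bounded 3 (4 / e) up \<and>
    (\<forall>x. lo x \<le> threshold_ind U V (\<alpha> j + \<beta> j * x)) \<and> (\<forall>x. threshold_ind U V (\<alpha> j + \<beta> j * x) \<le> up x) \<and>
    (\<forall>x. up x - lo x \<le> indicator {c - e..c + e} x + indicator {d - e..d + e} x) \<and> (\<beta> j = 0 \<longrightarrow> up = lo)"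
    for j lo up c d
  have "\<forall>j\<in>J. \<exists>lo up c d. Q j lo up c d"
    unfolding Q_def by (intro ballI threshold_ind_sandwich U V e \<beta>)
  then obtain lo up c d where Q: "\<And>j. j \<in> J \<Longrightarrow> Q j (lo j) (up j) (c j) (d j)"
    by metis
  have lu: "\<And>j. j \<in> J \<Longrightarrow> smooth_bounded 3 (4 / e) (lo j)"
    "\<And>j. j \<in> J \<Longrightarrow> smooth_bounded 3 (4 / e) (up j)"
    "\<And>j x. j \<in> J \<Longrightarrow> lo j x \<le> threshold_ind U V (\<alpha> j + \<beta> j * x)"
    "\<And>j x. j \<in> J \<Longrightarrow> threshold_ind U V (\<alpha> j + \<beta> j * x) \<le> up j x"
    "\<And>j x. j \<in> J \<Longrightarrow> up j x - lo j x \<le> indicator {c j - e..c j + e} x + indicator {d j - e..d j + e} x"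
    "\<And>j. j \<in> J \<Longrightarrow> \<beta> j = 0 \<Longrightarrow> up j = lo j"
    using Q unfolding Q_def by auto
  define b where "b j z = (\<Sum>i\<in>I. B j i * z i)" for j and z :: "'i \<Rightarrow> real"
  have b_meas [measurable]: "b j \<in> borel_measurable P" for j
    unfolding b_def by measurable
  have [measurable]: "lo j \<in> borel_measurable borel" "up j \<in> borel_measurable borel" if "j \<in> J" for j
    using lu(1,2)[OF that] by (auto intro: smooth_bounded_measurable)
  have bounds: "\<bar>lo j x\<bar> \<le> 3" "\<bar>up j x\<bar> \<le> 3" if "j \<in> J" for j x
    using lu(1,2)[OF that] by (auto simp: smooth_bounded_def)
  have int: "integrable P (\<lambda>z. lo j (b j z))" "integrable P (\<lambda>z. up j (b j z))" if "j \<in> J" for j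
    using that bounds[OF that] by (auto intro!: P.integrable_const_bound[where B = 3])
  have f_bound: "\<bar>threshold_ind U V x\<bar> \<le> 2" for x
    by (auto simp: threshold_ind_def split: split_indicator)
  have int_f: "integrable P (\<lambda>z. threshold_ind U V (\<alpha> j + \<beta> j * b j z))" for j
    by (rule P.integrable_const_bound[where B = 2]) (use f_bound in auto)
  \<comment> \<open>\<open>Lo\<close> is the negated lower bound, so that the upper tail estimate
    serves both directions.\<close>
  define Lo Up where "Lo z = (\<Sum>j\<in>J. - (1 / n) * lo j (b j z))" and "Up z = (\<Sum>j\<in>J. (1 / n) * up j (b j z))" for z
  have int_LU: "integrable P Lo" "integrable P Up" and int_T: "integrable P T"
    unfolding Lo_def Up_def T_def b_def[symmetric] using int int_f by auto
  have gap: "(\<integral>z. up j (b j z) \<partial>P) - (\<integral>z. lo j (b j z) \<partial>P) \<le> 2 * e" if j: "j \<in> J" for j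
  proof (cases "\<beta> j = 0")
    case True
    then show ?thesis using lu(6)[OF j] e by simp
  next
    case False
    then have Bj: "(\<Sum>i\<in>I. (B j i)\<^sup>2) = 1" using B[OF j] by simp
    have ii: "integrable P (\<lambda>z. indicator {x - e..x + e} (b j z) :: real)" for x :: real
      by (rule P.integrable_const_bound[where B = 1]) auto
    have ball: "(\<integral>z. indicator {x - e..x + e} (b j z) \<partial>P) \<le> e" for x
      using std_normal_small_ball[OF I Bj, of e x] e unfolding b_def P_def by simp
    have "(\<integral>z. up j (b j z) \<partial>P) - (\<integral>z. lo j (b j z) \<partial>P) = (\<integral>z. up j (b j z) - lo j (b j z) \<partial>P)"
      using int[OF j] by simp
    also have "\<dots> \<le> (\<integral>z. indicator {c j - e..c j + e} (b j z) + indicator {d j - e..d j + e} (b j z) \<partial>P)"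
      using int[OF j] ii lu(5)[OF j] by (intro integral_mono) auto
    also have "\<dots> \<le> 2 * e"
      using ball[of "c j"] ball[of "d j"] ii by simp
    finally show ?thesis .
  qed
  have "(\<integral>z. Up z \<partial>P) + (\<integral>z. Lo z \<partial>P) = (1 / n) * (\<Sum>j\<in>J. (\<integral>z. up j (b j z) \<partial>P) - (\<integral>z. lo j (b j z) \<partial>P))"
    unfolding Lo_def Up_def using int
    by (simp add: sum_negf sum_subtractf sum_divide_distrib diff_divide_distrib)
  also have "\<dots> \<le> (1 / n) * (card J * (2 * e))"
    using n gap sum_bounded_above[of J "\<lambda>j. (\<integral>z. up j (b j z) \<partial>P) - (\<integral>z. lo j (b j z) \<partial>P)" "2 * e"]
    by (intro mult_left_mono) auto
  also have "\<dots> \<le> 2 * e"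
    using n e by (simp add: field_simps)
  finally have gap_sum: "(\<integral>z. Up z \<partial>P) + (\<integral>z. Lo z \<partial>P) \<le> 2 * e" .
  have TU: "T z / n \<le> Up z" and TL: "- Lo z \<le> T z / n" for z
  proof -
    have "T z \<le> (\<Sum>j\<in>J. up j (b j z))" "(\<Sum>j\<in>J. lo j (b j z)) \<le> T z"
      unfolding T_def b_def[symmetric] by (intro sum_mono lu; assumption)+
    then show "T z / n \<le> Up z" "- Lo z \<le> T z / n"
      using n by (simp_all add: Up_def Lo_def sum_negf divide_right_mono flip: sum_divide_distrib)
  qed
  have ETU: "(\<integral>z. T z \<partial>P) / n \<le> (\<integral>z. Up z \<partial>P)"
    using integral_mono[OF _ int_LU(2), of "\<lambda>z. T z / n"] int_T TU by simp
  have ETL: "- (\<integral>z. Lo z \<partial>P) \<le> (\<integral>z. T z \<partial>P) / n"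
    using integral_mono[OF _ _ TL, of P] int_T int_LU by simp
  let ?AU = "{z \<in> space P. Up z - (\<integral>z. Up z \<partial>P) \<ge> e}"
  let ?AL = "{z \<in> space P. Lo z - (\<integral>z. Lo z \<partial>P) \<ge> e}"
  have conc: "measure P {z \<in> space P. (\<Sum>j\<in>J. k * g j (b j z)) - (\<integral>z. (\<Sum>j\<in>J. k * g j (b j z)) \<partial>P) \<ge> e}
      \<le> exp (- 2 * e\<^sup>2 / (pi\<^sup>2 * W))"
    if k: "\<bar>k\<bar> = 1 / n" and g: "\<And>j. j \<in> J \<Longrightarrow> smooth_bounded 3 (4 / e) (g j)" for k g
  proof -
    \<comment> \<open>The factor \<open>1 / n\<close> goes into the derivative bound, which becomes
      \<open>4 / (e * n)\<close>.\<close>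
    have "(\<bar>k\<bar> * (4 / e))\<^sup>2 * (\<Sum>j\<in>J. \<Sum>k\<in>J. \<bar>\<Sum>i\<in>I. B j i * B k i\<bar>) \<le> W"
      using W(1) by (simp add: k mult.commute)
    from smooth_bounded_concentration[OF I J smooth_bounded_cmult[OF g] this W(2)] e
    show ?thesis
      unfolding b_def P_def by simp
  qed
  have "{z \<in> space P. \<bar>T z - (\<integral>z. T z \<partial>P)\<bar> / n \<ge> 3 * e} \<subseteq> ?AU \<union> ?AL"
  proof
    fix z assume "z \<in> {z \<in> space P. \<bar>T z - (\<integral>z. T z \<partial>P)\<bar> / n \<ge> 3 * e}"
    then have z: "z \<in> space P" and "3 * e \<le> \<bar>T z / n - (\<integral>z. T z \<partial>P) / n\<bar>"
      using n by (simp_all add: abs_divide flip: diff_divide_distrib)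
    \<comment> \<open>The mean of \<open>Up\<close> exceeds that of \<open>T / n\<close> by at most
      \<open>2 * e\<close>, so an upward deviation of \<open>T / n\<close> leaves at least
      \<open>e\<close> for \<open>Up\<close>; a downward one leaves \<open>e\<close> for
      \<open>Lo\<close> in the same way.\<close>
    then have "e \<le> Up z - (\<integral>z. Up z \<partial>P) \<or> e \<le> Lo z - (\<integral>z. Lo z \<partial>P)"
      using TU[of z] TL[of z] ETU ETL gap_sum by linarith
    with z show "z \<in> ?AU \<union> ?AL" by auto
  qed
  then have "measure P {z \<in> space P. \<bar>T z - (\<integral>z. T z \<partial>P)\<bar> / n \<ge> 3 * e} \<le> measure P (?AU \<union> ?AL)"
    using int_LU by (intro P.finite_measure_mono) auto
  also have "\<dots> \<le> measure P ?AU + measure P ?AL"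
    using int_LU by (intro measure_Un_le) auto
  also have "measure P ?AU \<le> exp (- 2 * e\<^sup>2 / (pi\<^sup>2 * W))"
    unfolding Up_def using conc[of "1 / n" up] lu(2) n by simp
  also have "measure P ?AL \<le> exp (- 2 * e\<^sup>2 / (pi\<^sup>2 * W))"
    unfolding Lo_def using conc[of "- (1 / n)" lo] lu(1) n by simp
  finally show ?thesis by simp
qed

section \<open>Rejection counts\<close>

lemma normal_vector_measurable: "normal_vector M m X a C \<Longrightarrow> X \<in> measurable M (vec_space m)"
  by (simp add: normal_vector_def)

lemma normal_vector_var_nonneg:
  assumes "normal_vector M m X a C" "i \<in> {1..m}"
  shows "0 \<le> C i i"
  using assms by (auto simp: normal_vector_def intro!: sum_nonneg)

lemma reject_ind_measurable:
  assumes [measurable]: "p \<in> borel_measurable borel" and "i \<in> {1..m}"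
  shows "(\<lambda>(h, y). reject_ind p t \<mu> s h y i) \<in> borel_measurable (vec_space m \<Otimes>\<^sub>M vec_space m)"
proof -
  have [measurable]: "(\<lambda>h. h i) \<in> borel_measurable (vec_space m)"
    using assms(2) by (rule measurable_component_singleton)
  show ?thesis
    unfolding reject_ind_def split_beta' by measurable
qed

lemma rejection_sum_measurable:
  assumes "p \<in> borel_measurable borel" and "S \<subseteq> {1..m}"
  shows "(\<lambda>(h, y). \<Sum>i\<in>S. reject_ind p t \<mu> s h y i) \<in> borel_measurable (vec_space m \<Otimes>\<^sub>M vec_space m)"
proof -
  have "(\<lambda>z. \<Sum>i\<in>S. case z of (h, y) \<Rightarrow> reject_ind p t \<mu> s h y i)
      \<in> borel_measurable (vec_space m \<Otimes>\<^sub>M vec_space m)"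
    using assms by (intro borel_measurable_sum reject_ind_measurable) auto
  then show ?thesis
    by (simp add: split_beta')
qed

text \<open>\<open>v\<close> has the law of \<open>A\<close> applied to a standard normal vector.
  Dividing each row by its standard deviation gives \<open>B\<close>, whose Gram matrix is the
  correlation matrix, while \<open>\<mu> + h\<close> only shifts the thresholds. Hence the bound is
  uniform in \<open>h\<close>.\<close>

lemma rejection_sum_concentration:
  fixes t e W :: real and \<mu> s h :: "nat \<Rightarrow> real" and m :: nat
  assumes p: "p = one_sided_pvalue \<or> p = two_sided_pvalue"
    and m: "1 \<le> m" and S: "S \<subseteq> {1..m}" and v: "normal_vector M m v (\<lambda>_. 0) C"
    and s: "\<And>i. i \<in> {1..m} \<Longrightarrow> 0 \<le> s i" and e: "0 < e"
    and W: "(4 / (e * m))\<^sup>2 * mat_norm1 m (corr_matrix C) \<le> W" "0 < W"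
    and h: "h \<in> space (vec_space m)"
  defines "N \<equiv> \<lambda>y. \<Sum>i\<in>S. reject_ind p t \<mu> s h y i"
  shows "measure (law M m v) {y \<in> space (vec_space m). \<bar>N y - (\<integral>y. N y \<partial>law M m v)\<bar> / m \<ge> 3 * e} \<le>
    2 * exp (- 2 * e\<^sup>2 / (pi\<^sup>2 * W))"
proof -
  obtain k :: nat and A where C: "\<And>i j. i \<in> {1..m} \<Longrightarrow> j \<in> {1..m} \<Longrightarrow> C i j = (\<Sum>l<k. A i l * A j l)"
    and lawv: "law M m v = law (PiM {..<k} (\<lambda>_. std_normal_distribution)) m
        (\<lambda>z. \<lambda>i\<in>{1..m}. 0 + (\<Sum>l<k. A i l * z l))"
    using v unfolding normal_vector_def by blast
  define P where "P = PiM {..<k} (\<lambda>_. std_normal_distribution)"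
  define E where "E z = (\<lambda>i\<in>{1..m}. 0 + (\<Sum>l<k. A i l * z l))" for z
  have [measurable_cong]: "sets P = sets (PiM {..<k} (\<lambda>_. borel))"
    unfolding P_def by (intro sets_PiM_cong) simp_all
  have E [measurable]: "E \<in> measurable P (vec_space m)"
    unfolding E_def by measurable
  obtain U V where U: "up_closed U" and V: "up_closed V"
    and UV: "\<And>x. (if p x \<le> t then 1 else 0) = threshold_ind U V x"
    using pvalue_threshold_ind[OF p] by blast
  have p_meas: "p \<in> borel_measurable borel"
    using p by (rule pvalue_measurable)
  then have f_meas: "threshold_ind U V \<in> borel_measurable borel"
    unfolding UV[symmetric, abs_def] by measurable
  define \<alpha> where "\<alpha> j = (\<mu> j + h j) / sqrt (s j)" for j
  define \<beta> where "\<beta> j = std_dev C j / sqrt (s j)" for j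
  \<comment> \<open>A component of zero variance gets the zero row, as \<open>x / 0 = 0\<close>; it is constant since then \<open>\<beta> j = 0\<close>.\<close>
  define B where "B j l = A j l / std_dev C j" for j l
  have sd: "(std_dev C j)\<^sup>2 = (\<Sum>l<k. (A j l)\<^sup>2)" if "j \<in> {1..m}" for j
    unfolding std_dev_def using C[OF that that] by (simp add: power2_eq_square sum_nonneg)
  \<comment> \<open>A vanishing standard deviation forces the row of \<open>A\<close> to vanish, so
    multiplying back recovers the form even then.\<close>
  have sd_B: "std_dev C j * (\<Sum>l<k. B j l * z l) = (\<Sum>l<k. A j l * z l)" if "j \<in> {1..m}" for j z
  proof (cases "std_dev C j = 0")
    case True
    then have "\<forall>l<k. A j l = 0"
      using sd[OF that] by (subst (asm) eq_commute) (simp add: sum_nonneg_eq_0_iff)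
    then show ?thesis using True by simp
  next
    case False
    then show ?thesis by (simp add: B_def sum_distrib_left)
  qed
  have B: "\<beta> j = 0 \<or> (\<Sum>l<k. (B j l)\<^sup>2) = 1" if "j \<in> {1..m}" for j
    by (cases "std_dev C j = 0")
      (simp_all add: \<beta>_def B_def power_divide sd[OF that, symmetric] flip: sum_divide_distrib)
  \<comment> \<open>A zero row makes both sides \<open>0\<close>, in agreement with the convention
    for components of zero variance.\<close>
  have corr: "(\<Sum>l<k. B i l * B j l) = corr_matrix C i j" if "i \<in> {1..m}" "j \<in> {1..m}" for i j
    by (simp add: B_def corr_matrix_def C[OF that] sum_divide_distrib)
  define T where "T z = (\<Sum>j\<in>S. threshold_ind U V (\<alpha> j + \<beta> j * (\<Sum>l<k. B j l * z l)))" for z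
  have NE: "N (E z) = T z" for z
    unfolding N_def T_def
  proof (rule sum.cong[OF refl])
    fix j assume "j \<in> S"
    then have j: "j \<in> {1..m}" using S by auto
    have "(\<mu> j + h j + E z j) / sqrt (s j) = \<alpha> j + \<beta> j * (\<Sum>l<k. B j l * z l)"
      using j sd_B[OF j, of z] by (simp add: E_def \<alpha>_def \<beta>_def add_divide_distrib)
    then show "reject_ind p t \<mu> s h (E z) j = threshold_ind U V (\<alpha> j + \<beta> j * (\<Sum>l<k. B j l * z l))"
      unfolding reject_ind_def UV by simp
  qed
  have law_eq: "law M m v = distr P (vec_space m) E"
    unfolding lawv P_def E_def ..
  have N_meas [measurable]: "N \<in> borel_measurable (vec_space m)"
    using measurable_Pair2[OF rejection_sum_measurable[OF p_meas S] h] by (simp add: N_def)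
  have EN: "(\<integral>y. N y \<partial>law M m v) = (\<integral>z. T z \<partial>P)"
    unfolding law_eq integral_distr[OF E N_meas] NE ..
  have "measure (law M m v) {y \<in> space (vec_space m). \<bar>N y - (\<integral>y. N y \<partial>law M m v)\<bar> / m \<ge> 3 * e} =
      measure P (E -` {y \<in> space (vec_space m). \<bar>N y - (\<integral>y. N y \<partial>law M m v)\<bar> / m \<ge> 3 * e} \<inter> space P)"
    unfolding EN law_eq by (rule measure_distr) measurable
  also have "E -` {y \<in> space (vec_space m). \<bar>N y - (\<integral>y. N y \<partial>law M m v)\<bar> / m \<ge> 3 * e} \<inter> space P =
      {z \<in> space P. \<bar>T z - (\<integral>z. T z \<partial>P)\<bar> / m \<ge> 3 * e}"
    unfolding EN using measurable_space[OF E] by (auto simp: NE)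
  also have "measure P \<dots> \<le> 2 * exp (- 2 * e\<^sup>2 / (pi\<^sup>2 * W))"
    unfolding P_def T_def
  proof (rule threshold_sum_concentration[OF _ _ U V f_meas])
    have "(\<Sum>i\<in>S. \<Sum>j\<in>S. \<bar>\<Sum>l<k. B i l * B j l\<bar>) = (\<Sum>i\<in>S. \<Sum>j\<in>S. \<bar>corr_matrix C i j\<bar>)"
      using S by (intro sum.cong refl arg_cong[where f = abs] corr) auto
    also have "\<dots> \<le> (\<Sum>i\<in>S. \<Sum>j\<in>{1..m}. \<bar>corr_matrix C i j\<bar>)"
      using S by (intro sum_mono sum_mono2) auto
    also have "\<dots> \<le> mat_norm1 m (corr_matrix C)"
      unfolding mat_norm1_def using S by (intro sum_mono2) (auto intro: sum_nonneg)
    finally have "(4 / (e * m))\<^sup>2 * (\<Sum>i\<in>S. \<Sum>j\<in>S. \<bar>\<Sum>l<k. B i l * B j l\<bar>) \<le>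
        (4 / (e * m))\<^sup>2 * mat_norm1 m (corr_matrix C)"
      by (rule mult_left_mono) simp
    with W(1) show "(4 / (e * m))\<^sup>2 * (\<Sum>i\<in>S. \<Sum>j\<in>S. \<bar>\<Sum>l<k. B i l * B j l\<bar>) \<le> W"
      by linarith
    show "finite S" using S finite_subset by blast
    show "real (card S) \<le> real m" using card_mono[OF _ S] by simp
    show "0 \<le> \<beta> j" if "j \<in> S" for j
    proof -
      have j: "j \<in> {1..m}"
        using S that by auto
      show ?thesis
        unfolding \<beta>_def std_dev_def
        by (intro divide_nonneg_nonneg real_sqrt_ge_zero normal_vector_var_nonneg[OF v j] s[OF j])
    qed
    show "\<beta> j = 0 \<or> (\<Sum>l<k. (B j l)\<^sup>2) = 1" if "j \<in> S" for j
      using B[of j] S that by auto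
  qed (use m e W in auto)
  finally show ?thesis .
qed

section \<open>Almost sure convergence of rejection counts\<close>

text \<open>The index sets \<open>S m\<close> are left open so that \<open>{1..m}\<close> covers all
  rejections and \<open>true_nulls\<close> the false ones.\<close>

lemma AE_rejection_sum_LIMSEQ:
  fixes M :: "'w measure" and \<delta> t :: real and \<mu> s :: "nat \<Rightarrow> nat \<Rightarrow> real"
    and \<eta> v :: "nat \<Rightarrow> 'w \<Rightarrow> nat \<Rightarrow> real" and C :: "nat \<Rightarrow> nat \<Rightarrow> nat \<Rightarrow> real"
  assumes "prob_space M"
    and p: "p = one_sided_pvalue \<or> p = two_sided_pvalue"
    and \<eta>: "\<And>m. m \<ge> 1 \<Longrightarrow> \<eta> m \<in> measurable M (vec_space m)"
    and v: "\<And>m. m \<ge> 1 \<Longrightarrow> normal_vector M m (v m) (\<lambda>_. 0) (C m)"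
    and indep: "\<And>m. m \<ge> 1 \<Longrightarrow> prob_space.indep_var M (vec_space m) (\<eta> m) (vec_space m) (v m)"
    and s: "\<And>m i. m \<ge> 1 \<Longrightarrow> i \<in> {1..m} \<Longrightarrow> 0 \<le> s m i"
    and \<delta>: "0 < \<delta>"
    and R: "(\<lambda>m. mat_norm1 m (corr_matrix (C m)) / (real m)\<^sup>2) \<in> O(\<lambda>m. real m powr (- \<delta>))"
    and S: "\<And>m. S m \<subseteq> {1..m}"
  defines "N \<equiv> \<lambda>m h y. \<Sum>i\<in>S m. reject_ind p t (\<mu> m) (s m) h y i"
  shows "AE \<omega> in M. (\<lambda>m. \<bar>N m (\<eta> m \<omega>) (v m \<omega>) - (\<integral>y. N m (\<eta> m \<omega>) y \<partial>law M m (v m))\<bar> / real m) \<longlonglongrightarrow> 0"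
proof -
  interpret prob_space M by fact
  define D where "D m h y = \<bar>N m h y - (\<integral>y. N m h y \<partial>law M m (v m))\<bar> / real m" for m h y
  have p_meas: "p \<in> borel_measurable borel"
    using p by (rule pvalue_measurable)
  obtain c where c: "0 < c"
    and R_le: "\<forall>\<^sub>F m in sequentially. norm (mat_norm1 m (corr_matrix (C m)) / (real m)\<^sup>2) \<le> c * norm (real m powr (- \<delta>))"
    using landau_o.bigE[OF R] by blast
  have ev: "AE \<omega> in M. \<forall>\<^sub>F m in sequentially. D m (\<eta> m \<omega>) (v m \<omega>) < 3 * e" if e: "0 < e" for e :: real
  proof -
    \<comment> \<open>\<open>A 0\<close> is empty because nothing is assumed about
      \<open>\<eta> 0\<close> and \<open>v 0\<close>.\<close>
    define A where "A m = (if m = 0 then {} else {\<omega> \<in> space M. D m (\<eta> m \<omega>) (v m \<omega>) \<ge> 3 * e})" for m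
    \<comment> \<open>\<open>W\<close> stays free: it is used below with an arbitrary positive bound
      to obtain measurability for every \<open>m\<close>, and with the assumed rate for large
      \<open>m\<close>.\<close>
    have A: "A m \<in> sets M \<and> measure M (A m) \<le> 2 * exp (- 2 * e\<^sup>2 / (pi\<^sup>2 * W))"
      if W: "(4 / (e * m))\<^sup>2 * mat_norm1 m (corr_matrix (C m)) \<le> W" "0 < W" and m: "1 \<le> m" for m W
    proof -
      note [measurable] = \<eta>[OF m] normal_vector_measurable[OF v[OF m]]
      interpret v: prob_space "law M m (v m)"
        by (rule prob_space_distr) measurable
      have N [measurable]: "(\<lambda>(h, y). N m h y) \<in> borel_measurable (vec_space m \<Otimes>\<^sub>M vec_space m)"
        unfolding N_def by (rule rejection_sum_measurable[OF p_meas S])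
      have "(\<lambda>h. \<integral>y. N m h y \<partial>law M m (v m)) \<in> borel_measurable (vec_space m)"
        using N by (intro v.borel_measurable_lebesgue_integral)
          (subst measurable_cong_sets[OF sets_pair_measure_cong[OF refl sets_distr] refl])
      then have D [measurable]: "(\<lambda>(h, y). D m h y) \<in> borel_measurable (vec_space m \<Otimes>\<^sub>M vec_space m)"
        unfolding D_def split_beta' using N by (auto simp: split_beta')
      define X where "X = {z \<in> space (vec_space m \<Otimes>\<^sub>M vec_space m). D m (fst z) (snd z) \<ge> 3 * e}"
      have X [measurable]: "X \<in> sets (vec_space m \<Otimes>\<^sub>M vec_space m)"
        unfolding X_def using D by (auto simp: split_beta')
      \<comment> \<open>By independence the joint law is a product, so fixing \<open>\<eta>\<close>
        amounts to taking a section, and the uniform bound integrates to itself.\<close>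
      have joint: "law M m (\<eta> m) \<Otimes>\<^sub>M law M m (v m) = distr M (vec_space m \<Otimes>\<^sub>M vec_space m) (\<lambda>\<omega>. (\<eta> m \<omega>, v m \<omega>))"
        using indep[OF m] by (simp add: indep_var_distribution_eq)
      have A_eq: "A m = (\<lambda>\<omega>. (\<eta> m \<omega>, v m \<omega>)) -` X \<inter> space M"
        using m measurable_space[OF \<eta>[OF m]] measurable_space[OF normal_vector_measurable[OF v[OF m]]]
        by (auto simp: A_def X_def space_pair_measure)
      have A_sets: "A m \<in> sets M"
        unfolding A_eq by measurable
      have "emeasure M (A m) = emeasure (law M m (\<eta> m) \<Otimes>\<^sub>M law M m (v m)) X"
        unfolding A_eq joint by (rule emeasure_distr[symmetric]) measurable
      also have "\<dots> = (\<integral>\<^sup>+h. emeasure (law M m (v m)) (Pair h -` X) \<partial>law M m (\<eta> m))"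
        using X by (intro v.emeasure_pair_measure_alt)
          (subst sets_pair_measure_cong[OF sets_distr sets_distr])
      also have "\<dots> \<le> (\<integral>\<^sup>+h. ennreal (2 * exp (- 2 * e\<^sup>2 / (pi\<^sup>2 * W))) \<partial>law M m (\<eta> m))"
      proof (rule nn_integral_mono)
        fix h assume "h \<in> space (law M m (\<eta> m))"
        then have h: "h \<in> space (vec_space m)" by simp
        have "Pair h -` X = {y \<in> space (vec_space m). D m h y \<ge> 3 * e}"
          using h by (auto simp: X_def space_pair_measure)
        then have "measure (law M m (v m)) (Pair h -` X) \<le> 2 * exp (- 2 * e\<^sup>2 / (pi\<^sup>2 * W))"
          using rejection_sum_concentration[OF p m S v[OF m] s[OF m] e W h] by (simp add: D_def N_def)
        then show "emeasure (law M m (v m)) (Pair h -` X) \<le> ennreal (2 * exp (- 2 * e\<^sup>2 / (pi\<^sup>2 * W)))"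
          unfolding v.emeasure_eq_measure by (rule ennreal_leI)
      qed
      also have "\<dots> = ennreal (2 * exp (- 2 * e\<^sup>2 / (pi\<^sup>2 * W)))"
        using prob_space.emeasure_space_1[OF prob_space_distr[OF \<eta>[OF m]]] by simp
      finally show ?thesis
        using A_sets by (simp add: emeasure_eq_measure)
    qed
    have A_sets: "A m \<in> sets M" for m
    proof (cases "m = 0")
      case False
      then show ?thesis
        using A[of m "max 1 ((4 / (e * m))\<^sup>2 * mat_norm1 m (corr_matrix (C m)))"] by simp
    qed (simp add: A_def)
    \<comment> \<open>Chosen so that \<open>\<kappa> * real m powr \<delta>\<close> is
      \<open>2 * e\<^sup>2 / (pi\<^sup>2 * W)\<close> for the \<open>W\<close> below;
      \<open>16 / e\<^sup>2\<close> is the square of \<open>4 / e\<close>, and \<open>c\<close> is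
      the constant of the assumed rate.\<close>
    define \<kappa> where "\<kappa> = 2 * e\<^sup>2 / (pi\<^sup>2 * (16 / e\<^sup>2 * c))"
    have \<kappa>: "0 < \<kappa>"
      using e c by (simp add: \<kappa>_def)
    have "\<forall>\<^sub>F m in sequentially. norm (measure M (A m)) \<le> 2 * exp (- \<kappa> * real m powr \<delta>)"
      using R_le eventually_ge_at_top[of 1]
    proof eventually_elim
      case (elim m)
      define W where "W = 16 / e\<^sup>2 * (c * real m powr (- \<delta>))"
      have W_pos: "0 < W"
        using elim c e by (simp add: W_def)
      have "(4 / (e * m))\<^sup>2 * mat_norm1 m (corr_matrix (C m)) =
          16 / e\<^sup>2 * (mat_norm1 m (corr_matrix (C m)) / (real m)\<^sup>2)"
        by (simp add: power_divide power_mult_distrib)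
      also have "\<dots> \<le> W"
        unfolding W_def using abs_le_D1[OF elim(1)[unfolded real_norm_def]]
        by (intro mult_left_mono) auto
      finally have "measure M (A m) \<le> 2 * exp (- 2 * e\<^sup>2 / (pi\<^sup>2 * W))"
        using A[OF _ W_pos elim(2)] by simp
      also have "- 2 * e\<^sup>2 / (pi\<^sup>2 * W) = - \<kappa> * real m powr \<delta>"
        using elim c e by (simp add: W_def \<kappa>_def powr_minus field_simps)
      finally show ?case by simp
    qed
    moreover have "summable (\<lambda>m. 2 * exp (- \<kappa> * real m powr \<delta>))"
    proof (rule summable_comparison_test_bigo)
      show "summable (\<lambda>m. norm (1 / real m ^ 2))"
        using inverse_power_summable[of 2] by (simp add: inverse_eq_divide)
      show "(\<lambda>m. 2 * exp (- \<kappa> * real m powr \<delta>)) \<in> O(\<lambda>m. 1 / real m ^ 2)"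
        using \<kappa> \<delta> by real_asymp
    qed
    ultimately have "summable (\<lambda>m. measure M (A m))"
      by (rule summable_comparison_test_ev)
    then have "AE \<omega> in M. \<forall>\<^sub>F m in sequentially. \<omega> \<in> space M - A m"
      by (intro borel_cantelli_AE1 A_sets) (simp_all add: emeasure_eq_measure)
    then show ?thesis
    proof eventually_elim
      case (elim \<omega>)
      from elim eventually_gt_at_top[of 0] show ?case
        by eventually_elim (auto simp: A_def not_le)
    qed
  qed
  \<comment> \<open>Only countably many tolerances may share one null set.\<close>
  have "AE \<omega> in M. \<forall>n. \<forall>\<^sub>F m in sequentially. D m (\<eta> m \<omega>) (v m \<omega>) < 3 * (1 / real (Suc n))"
    by (subst AE_all_countable, intro allI ev) simp
  then show ?thesis
  proof eventually_elim
    case (elim \<omega>)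
    show ?case
      unfolding D_def[symmetric]
    proof (rule order_tendstoI)
      fix a :: real assume "a < 0"
      then show "\<forall>\<^sub>F m in sequentially. a < D m (\<eta> m \<omega>) (v m \<omega>)"
        by (intro always_eventually allI) (simp add: D_def less_le_trans)
    next
      fix a :: real assume "0 < a"
      then obtain n where "1 / real (Suc n) < a / 3"
        using nat_approx_posE[of "a / 3"] by auto
      with elim[rule_format, of n] show "\<forall>\<^sub>F m in sequentially. D m (\<eta> m \<omega>) (v m \<omega>) < a"
        by (auto elim: eventually_mono)
    qed
  qed
qed

section \<open>The false discovery proportion\<close>

lemma false_discovery_prop_bounds:
  "0 \<le> false_discovery_prop p t m \<mu> s h y" "false_discovery_prop p t m \<mu> s h y \<le> 1"
proof -
  have S: "true_nulls m \<mu> \<subseteq> {1..m}"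
    by (auto simp: true_nulls_def)
  have nonneg: "0 \<le> reject_ind p t \<mu> s h y i" for i
    by (simp add: reject_ind_def)
  have "num_false_rejections p t m \<mu> s h y \<le> num_rejections p t m \<mu> s h y"
    unfolding num_false_rejections_def num_rejections_def using nonneg S by (intro sum_mono2) auto
  moreover have "0 \<le> num_false_rejections p t m \<mu> s h y"
    unfolding num_false_rejections_def using nonneg by (intro sum_nonneg)
  ultimately show "0 \<le> false_discovery_prop p t m \<mu> s h y" "false_discovery_prop p t m \<mu> s h y \<le> 1"
    by (auto simp: false_discovery_prop_def)
qed

lemma abs_diff_integral_le_1:
  fixes f :: "'a \<Rightarrow> real"
  assumes "prob_space M" and f: "\<And>x. 0 \<le> f x" "\<And>x. f x \<le> 1"
  shows "\<bar>f x - (\<integral>y. f y \<partial>M)\<bar> \<le> 1"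
proof -
  interpret prob_space M by fact
  have "0 \<le> (\<integral>y. f y \<partial>M)"
    using f by simp
  \<comment> \<open>A non-integrable \<open>f\<close> has integral \<open>0\<close> by convention,
    which satisfies the bound as well.\<close>
  moreover have "(\<integral>y. f y \<partial>M) \<le> 1"
  proof (cases "integrable M f")
    case True
    then show ?thesis using integral_mono[OF True, of "\<lambda>_. 1"] f by (simp add: prob_space)
  qed (simp add: not_integrable_integral_eq)
  ultimately show ?thesis using f[of x] by linarith
qed

theorem theorem3:
  fixes M :: "'w measure"
    and t \<delta> :: real
    and \<mu> :: "nat \<Rightarrow> nat \<Rightarrow> real"
    and \<eta> v :: "nat \<Rightarrow> 'w \<Rightarrow> nat \<Rightarrow> real"
    and C\<^sub>\<eta> C\<^sub>v :: "nat \<Rightarrow> nat \<Rightarrow> nat \<Rightarrow> real"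
    and \<sigma>\<^sub>0 :: ereal
    and s :: "nat \<Rightarrow> nat \<Rightarrow> real"
    and p :: "real \<Rightarrow> real"
  defines "s \<equiv> \<lambda>m i. C\<^sub>\<eta> m i i + C\<^sub>v m i i"
  assumes "prob_space M"
    and "0 < t" and "t < 1"
    and "p = one_sided_pvalue \<or> p = two_sided_pvalue"
    and "\<And>m. m \<ge> 1 \<Longrightarrow> normal_vector M m (\<eta> m) (\<lambda>_. 0) (C\<^sub>\<eta> m)"
    and "\<And>m. m \<ge> 1 \<Longrightarrow> normal_vector M m (v m) (\<lambda>_. 0) (C\<^sub>v m)"
    and "\<And>m. m \<ge> 1 \<Longrightarrow>
           prob_space.indep_var M (vec_space m) (\<eta> m) (vec_space m) (v m)"
    and "\<And>m i. m \<ge> 1 \<Longrightarrow> i \<in> {1..m} \<Longrightarrow> s m i \<noteq> 0"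
    and "(\<lambda>m. min_nonzero_sd m (C\<^sub>v m)) \<longlonglongrightarrow> \<sigma>\<^sub>0"
    and "\<sigma>\<^sub>0 > 0"
    and "\<delta> > 0"
    and "(\<lambda>m. mat_norm1 m (corr_matrix (C\<^sub>v m)) / (real m)\<^sup>2) \<in> O(\<lambda>m. real m powr (- \<delta>))"
    and "AE \<omega> in M. \<forall>\<epsilon>>0. \<exists>N. \<forall>m m'. N \<le> m \<and> m \<le> m' \<longrightarrow>
           Max {vec_norm2 m (\<lambda>i. \<eta> m \<omega> i - \<eta> m' \<omega> i),
                vec_norm2 m (\<lambda>i. \<mu> m i - \<mu> m' i),
                vec_norm2 m (\<lambda>i. std_dev (C\<^sub>v m) i - std_dev (C\<^sub>v m') i)} < \<epsilon>"
  shows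
    "(AE \<omega> in M. (\<lambda>m.
        \<bar>num_rejections p t m (\<mu> m) (s m) (\<eta> m \<omega>) (v m \<omega>)
          - (\<integral>y. num_rejections p t m (\<mu> m) (s m) (\<eta> m \<omega>) y \<partial>law M m (v m))\<bar> / real m)
        \<longlonglongrightarrow> 0) \<and>
     (AE \<omega> in M. (\<lambda>m.
        \<bar>num_false_rejections p t m (\<mu> m) (s m) (\<eta> m \<omega>) (v m \<omega>)
          - (\<integral>y. num_false_rejections p t m (\<mu> m) (s m) (\<eta> m \<omega>) y \<partial>law M m (v m))\<bar> / real m)
        \<longlonglongrightarrow> 0) \<and>
     (liminf (\<lambda>m. ereal (null_proportion m (\<mu> m))) > 0 \<longrightarrow>
      (AE \<omega> in M. (\<lambda>m.
        \<bar>false_discovery_prop p t m (\<mu> m) (s m) (\<eta> m \<omega>) (v m \<omega>)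
          - (\<integral>y. false_discovery_prop p t m (\<mu> m) (s m) (\<eta> m \<omega>) y \<partial>law M m (v m))\<bar> / real m)
        \<longlonglongrightarrow> 0))"
proof -
  have s_nonneg: "0 \<le> s m i" if "m \<ge> 1" "i \<in> {1..m}" for m i
    using normal_vector_var_nonneg[OF assms(6)[OF that(1)] that(2)]
      normal_vector_var_nonneg[OF assms(7)[OF that(1)] that(2)]
    by (simp add: s_def)
  have LIMSEQ: "AE \<omega> in M. (\<lambda>m. \<bar>(\<Sum>i\<in>S m. reject_ind p t (\<mu> m) (s m) (\<eta> m \<omega>) (v m \<omega>) i) -
      (\<integral>y. (\<Sum>i\<in>S m. reject_ind p t (\<mu> m) (s m) (\<eta> m \<omega>) y i) \<partial>law M m (v m))\<bar> / real m) \<longlonglongrightarrow> 0"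
    if "\<And>m. S m \<subseteq> {1..m}" for S
    by (rule AE_rejection_sum_LIMSEQ[OF assms(2,5) normal_vector_measurable[OF assms(6)] assms(7,8)
        s_nonneg assms(12,13) that])
  have "AE \<omega> in M. (\<lambda>m.
        \<bar>num_rejections p t m (\<mu> m) (s m) (\<eta> m \<omega>) (v m \<omega>)
          - (\<integral>y. num_rejections p t m (\<mu> m) (s m) (\<eta> m \<omega>) y \<partial>law M m (v m))\<bar> / real m)
        \<longlonglongrightarrow> 0"
    unfolding num_rejections_def by (rule LIMSEQ) simp
  moreover have "AE \<omega> in M. (\<lambda>m.
        \<bar>num_false_rejections p t m (\<mu> m) (s m) (\<eta> m \<omega>) (v m \<omega>)
          - (\<integral>y. num_false_rejections p t m (\<mu> m) (s m) (\<eta> m \<omega>) y \<partial>law M m (v m))\<bar> / real m)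
        \<longlonglongrightarrow> 0"
    unfolding num_false_rejections_def by (rule LIMSEQ) (auto simp: true_nulls_def)
  \<comment> \<open>The proportion and its mean differ by at most one, so the normalised deviation
    is at most \<open>1 / m\<close> for every \<open>\<omega>\<close>.\<close>
  moreover have "(\<lambda>m.
        \<bar>false_discovery_prop p t m (\<mu> m) (s m) (\<eta> m \<omega>) (v m \<omega>)
          - (\<integral>y. false_discovery_prop p t m (\<mu> m) (s m) (\<eta> m \<omega>) y \<partial>law M m (v m))\<bar> / real m)
        \<longlonglongrightarrow> 0" for \<omega>
  proof (rule tendsto_sandwich[OF _ _ tendsto_const lim_1_over_n])
    show "\<forall>\<^sub>F m in sequentially.
        \<bar>false_discovery_prop p t m (\<mu> m) (s m) (\<eta> m \<omega>) (v m \<omega>)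
          - (\<integral>y. false_discovery_prop p t m (\<mu> m) (s m) (\<eta> m \<omega>) y \<partial>law M m (v m))\<bar> / real m
        \<le> 1 / of_nat m"
      using eventually_ge_at_top[of 1]
    proof eventually_elim
      case (elim m)
      have "prob_space (law M m (v m))"
        using assms(2) normal_vector_measurable[OF assms(7)[OF elim]] by (rule prob_space.prob_space_distr)
      from abs_diff_integral_le_1[OF this, where f = "false_discovery_prop p t m (\<mu> m) (s m) (\<eta> m \<omega>)",
          OF false_discovery_prop_bounds]
      show ?case by (intro divide_right_mono) auto
    qed
  qed (auto intro: always_eventually)
  ultimately show ?thesis by auto
qed

end
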